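(* Let $\Bbbk$ be a field of characteristic $0$ and $V$ an $n$-dimensional $\Bbbk$-vector space. The locus $U_{\mathrm{Comm}}$ is a finite union of open $\mathrm{GL}(V)$-orbits indexed by isomorphism classes of finite étale $\Bbbk$-algebras of dimension $n$. Over an algebraically closed field, $U_{\mathrm{Comm}}$ is a single open orbit corresponding to $\Bbbk^n$ with coordinate-wise product.
   Context: Fix a basis $(e_i)_{i=1}^n$ of $V$. $V^{2,1}=\mathrm{Hom}(V\otimes V,V)\cong\Bbbk^{n^3}$; each $x\in V^{2,1}$ has structure constants $x_{i,j}^\ell$ and determines the product $\mu_x(e_i,e_j)=\sum_\ell x_{i,j}^\ell e_\ell$; $V_x=(V,\mu_x)$. $\mathrm{Comm}(V)\subset V^{2,1}$ is the closed subscheme of associative products (cut out by the $n^4$ quadratic associativity equations) that are commutative (linear equations $x_{i,j}^\ell=x_{j,i}^\ell$). $\mathrm{GL}(V)$ acts by $(g\cdot\mu)(a,b)=g\,\mu(g^{-1}a,g^{-1}b)$. Let $L_z$ be left multiplication by $z$ in $V_x$ and $\Delta(x)=\det(\mathrm{Tr}(L_{e_ie_j}))_{i,j}$. Then $U_{\mathrm{Comm}}=\{x\in\mathrm{Comm}(V):\Delta(x)\neq0\}$. A finite étale $\Bbbk$-algebra is a finite product of finite separable field extensions of $\Bbbk$.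
   Formalization: As written this fails (over the rationals, n=2, there are infinitely many orbits of rational points, none open); the classification by étale algebras is proved for orbits of k-points, while finiteness and openness are proved for the orbits taken over the algebraic closure. *)

theory Defs
  imports
    "Jordan_Normal_Form.VS_Connect"
    "HOL-Algebra.Algebraic_Closure_Type"
    "HOL-Algebra.QuotRing"
begin

section \<open>Algebras over a field given as a type\<close>

text \<open>
  The base field is a type \<open>'k\<close>; the library's \<^term>\<open>class_ring\<close> is that field as a ring record.
  A commutative unital \<open>'k\<close>-algebra \<open>A\<close> is a record with \<^prop>\<open>algebra class_ring A\<close>.
\<close>

definition algebra_iso :: "('k::field, 'a) module \<Rightarrow> ('k, 'b) module \<Rightarrow> bool" where
  "algebra_iso A B \<longleftrightarrow> (\<exists>h \<in> ring_iso A B. h \<in> LinearCombinations.module_hom class_ring A B)"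

definition poly_at :: "('k::field, 'a) module \<Rightarrow> 'k poly \<Rightarrow> 'a \<Rightarrow> 'a" where
  "poly_at A p a = (\<Oplus>\<^bsub>A\<^esub>i\<in>{..Polynomial.degree p}. Polynomial.coeff p i \<odot>\<^bsub>A\<^esub> (a [^]\<^bsub>A\<^esub> i))"

text \<open>
  An irreducible \<open>p\<close> vanishing at \<open>a\<close> is the minimal polynomial of \<open>a\<close> up to a unit; it has no
  repeated root in an algebraic closure iff it is coprime to its derivative.
\<close>

definition separable_element :: "('k::field, 'a) module \<Rightarrow> 'a \<Rightarrow> bool" where
  "separable_element L a \<longleftrightarrow>
     (\<exists>p. Factorial_Ring.irreducible p \<and> poly_at L p a = \<zero>\<^bsub>L\<^esub> \<and> coprime p (pderiv p))"

definition finite_separable_extension :: "('k::field, 'a) module \<Rightarrow> bool" where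
  "finite_separable_extension L \<longleftrightarrow>
     algebra class_ring L \<and> Ring.field L \<and> vectorspace.fin_dim class_ring L \<and>
     (\<forall>a\<in>carrier L. separable_element L a)"

definition product_algebra ::
    "nat \<Rightarrow> (nat \<Rightarrow> ('k::field, 'a) module) \<Rightarrow> ('k, nat \<Rightarrow> 'a) module" where
  "product_algebra r L =
    \<lparr>carrier = (\<Pi>\<^sub>E i\<in>{..<r}. carrier (L i)),
     monoid.mult = (\<lambda>f g. \<lambda>i\<in>{..<r}. f i \<otimes>\<^bsub>L i\<^esub> g i),
     monoid.one = (\<lambda>i\<in>{..<r}. \<one>\<^bsub>L i\<^esub>),
     ring.zero = (\<lambda>i\<in>{..<r}. \<zero>\<^bsub>L i\<^esub>),
     ring.add = (\<lambda>f g. \<lambda>i\<in>{..<r}. f i \<oplus>\<^bsub>L i\<^esub> g i),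
     module.smult = (\<lambda>c f. \<lambda>i\<in>{..<r}. c \<odot>\<^bsub>L i\<^esub> f i)\<rparr>"

text \<open>
  The factors have their elements in the same type as \<open>A\<close>. This is no restriction: each factor of a
  product embeds into it as the functions vanishing at the other indices. The empty product
  \<open>r = 0\<close> is the zero algebra.
\<close>

definition finite_etale :: "('k::field, 'a) module \<Rightarrow> bool" where
  "finite_etale A \<longleftrightarrow> algebra class_ring A \<and>
     (\<exists>r (L :: nat \<Rightarrow> ('k, 'a) module).
        (\<forall>i<r. finite_separable_extension (L i)) \<and> algebra_iso A (product_algebra r L))"

definition base_algebra :: "('k::field, 'k) module" where
  "base_algebra =
    \<lparr>carrier = UNIV, monoid.mult = (*), monoid.one = 1,
     ring.zero = 0, ring.add = (+), module.smult = (*)\<rparr>"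

abbreviation coordinatewise_algebra :: "nat \<Rightarrow> ('k::field, nat \<Rightarrow> 'k) module" where
  "coordinatewise_algebra n \<equiv> product_algebra n (\<lambda>_. base_algebra)"

section \<open>Products on a vector space with a fixed basis\<close>

definition ordered_basis :: "('k::field, 'v) module \<Rightarrow> (nat \<Rightarrow> 'v) \<Rightarrow> nat \<Rightarrow> bool" where
  "ordered_basis V e n \<longleftrightarrow> vectorspace class_ring V \<and> inj_on e {..<n} \<and>
     vectorspace.basis class_ring V (e ` {..<n})"

definition coord :: "('k::field, 'v) module \<Rightarrow> (nat \<Rightarrow> 'v) \<Rightarrow> nat \<Rightarrow> 'v \<Rightarrow> nat \<Rightarrow> 'k" where
  "coord V e n v =
     (THE c. (\<forall>i\<ge>n. c i = 0) \<and> v = (\<Oplus>\<^bsub>V\<^esub>i\<in>{..<n}. c i \<odot>\<^bsub>V\<^esub> e i))"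

text \<open>
  A point of \<open>V\<^sup>2\<^sup>,\<^sup>1 = Hom(V \<otimes> V, V)\<close> is the array \<open>x i j l\<close> of its structure constants, with indices
  counted from \<open>0\<close>. Entries with an index \<open>\<ge> n\<close> are set to \<open>0\<close>, so that equality of points is
  equality of functions.
\<close>

type_synonym 'k strconst = "nat \<Rightarrow> nat \<Rightarrow> nat \<Rightarrow> 'k"

definition strconsts :: "nat \<Rightarrow> ('k::field) strconst set" where
  "strconsts n = {x. \<forall>i j l. \<not> (i < n \<and> j < n \<and> l < n) \<longrightarrow> x i j l = 0}"

definition mu ::
    "('k::field, 'v) module \<Rightarrow> (nat \<Rightarrow> 'v) \<Rightarrow> nat \<Rightarrow> 'k strconst \<Rightarrow> 'v \<Rightarrow> 'v \<Rightarrow> 'v" where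
  "mu V e n x u v =
     (\<Oplus>\<^bsub>V\<^esub>i\<in>{..<n}. \<Oplus>\<^bsub>V\<^esub>j\<in>{..<n}. \<Oplus>\<^bsub>V\<^esub>l\<in>{..<n}.
        (coord V e n u i * coord V e n v j * x i j l) \<odot>\<^bsub>V\<^esub> e l)"

text \<open>
  \<open>V\<^sub>x\<close>. The \<open>one\<close> field is the two-sided identity of the product; it is meaningful only if there is
  one.
\<close>

definition alg_of ::
    "('k::field, 'v) module \<Rightarrow> (nat \<Rightarrow> 'v) \<Rightarrow> nat \<Rightarrow> 'k strconst \<Rightarrow> ('k, 'v) module" where
  "alg_of V e n x = V\<lparr>monoid.mult := mu V e n x,
     monoid.one := (THE u. u \<in> carrier V \<and> (\<forall>v\<in>carrier V. mu V e n x u v = v \<and> mu V e n x v u = v))\<rparr>"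

definition Comm :: "nat \<Rightarrow> ('k::field) strconst set" where
  "Comm n = {x \<in> strconsts n.
     (\<forall>i<n. \<forall>j<n. \<forall>k<n. \<forall>m<n. (\<Sum>l<n. x i j l * x l k m) = (\<Sum>l<n. x j k l * x i l m)) \<and>
     (\<forall>i<n. \<forall>j<n. \<forall>l<n. x i j l = x j i l)}"

definition Tr :: "('k::field, 'v) module \<Rightarrow> (nat \<Rightarrow> 'v) \<Rightarrow> nat \<Rightarrow> ('v \<Rightarrow> 'v) \<Rightarrow> 'k" where
  "Tr V e n f = (\<Sum>i<n. coord V e n (f (e i)) i)"

definition Delta :: "('k::field, 'v) module \<Rightarrow> (nat \<Rightarrow> 'v) \<Rightarrow> nat \<Rightarrow> 'k strconst \<Rightarrow> 'k" where
  "Delta V e n x =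
     det (mat n n (\<lambda>(i, j). Tr V e n (mu V e n x (mu V e n x (e i) (e j)))))"

definition U_Comm :: "('k::field, 'v) module \<Rightarrow> (nat \<Rightarrow> 'v) \<Rightarrow> nat \<Rightarrow> 'k strconst set" where
  "U_Comm V e n = {x \<in> Comm n. Delta V e n x \<noteq> 0}"

definition GL :: "('k::field, 'v) module \<Rightarrow> ('v \<Rightarrow> 'v) set" where
  "GL V = {g \<in> LinearCombinations.module_hom class_ring V V. bij_betw g (carrier V) (carrier V)}"

text \<open>The structure constants of \<open>(a, b) \<mapsto> g (\<mu>\<^sub>x (g\<^sup>-\<^sup>1 a) (g\<^sup>-\<^sup>1 b))\<close>.\<close>

definition act :: "('k::field, 'v) module \<Rightarrow> (nat \<Rightarrow> 'v) \<Rightarrow> nat \<Rightarrow>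
    ('v \<Rightarrow> 'v) \<Rightarrow> 'k strconst \<Rightarrow> 'k strconst" where
  "act V e n g x = (\<lambda>i j l. if i < n \<and> j < n \<and> l < n then
     coord V e n (g (mu V e n x (inv_into (carrier V) g (e i)) (inv_into (carrier V) g (e j)))) l
     else 0)"

definition orbit ::
    "('k::field, 'v) module \<Rightarrow> (nat \<Rightarrow> 'v) \<Rightarrow> nat \<Rightarrow> 'k strconst \<Rightarrow> 'k strconst set" where
  "orbit V e n x = (\<lambda>g. act V e n g x) ` GL V"

text \<open>The points of \<open>Comm(V)\<close> whose algebra is isomorphic to \<open>A\<close>.\<close>

definition locus_of :: "('k::field, 'v) module \<Rightarrow> (nat \<Rightarrow> 'v) \<Rightarrow> nat \<Rightarrow>
    ('k, 'a) module \<Rightarrow> 'k strconst set" where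
  "locus_of V e n A = {x \<in> Comm n. algebra_iso (alg_of V e n x) A}"

section \<open>The Zariski topology and geometric points\<close>

text \<open>
  Polynomial functions in the structure constants, evaluated at points over \<open>'K\<close>, with coefficients
  in the image of \<open>\<iota> : 'k \<rightarrow> 'K\<close>.
\<close>

inductive_set poly_funs :: "('k::field \<Rightarrow> 'K::field) \<Rightarrow> nat \<Rightarrow> ('K strconst \<Rightarrow> 'K) set"
  for \<iota> :: "'k::field \<Rightarrow> 'K::field" and n :: nat where
  const: "(\<lambda>_. \<iota> c) \<in> poly_funs \<iota> n"
| var: "i < n \<Longrightarrow> j < n \<Longrightarrow> l < n \<Longrightarrow> (\<lambda>x. x i j l) \<in> poly_funs \<iota> n"
| add: "p \<in> poly_funs \<iota> n \<Longrightarrow> q \<in> poly_funs \<iota> n \<Longrightarrow> (\<lambda>x. p x + q x) \<in> poly_funs \<iota> n"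
| mult: "p \<in> poly_funs \<iota> n \<Longrightarrow> q \<in> poly_funs \<iota> n \<Longrightarrow> (\<lambda>x. p x * q x) \<in> poly_funs \<iota> n"

definition zariski_open_in ::
    "('k::field \<Rightarrow> 'K::field) \<Rightarrow> nat \<Rightarrow> 'K strconst set \<Rightarrow> 'K strconst set \<Rightarrow> bool" where
  "zariski_open_in \<iota> n Z S \<longleftrightarrow> (\<exists>P \<subseteq> poly_funs \<iota> n. S = {x \<in> Z. \<exists>p\<in>P. p x \<noteq> 0})"

text \<open>
  The \<open>\<^bold>k\<close>-scheme \<open>Comm(V)\<close> is handled through its points over the algebraic closure \<open>K\<close> of
  \<open>\<^bold>k\<close>, that is through products on \<open>V \<otimes> K = K\<^sup>n\<close> with the basis \<open>e\<^sub>i \<otimes> 1\<close>. Open subsets of the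
  scheme correspond to subsets of \<open>Comm(V)(K)\<close> that are open in the Zariski topology with
  coefficients in \<open>\<^bold>k\<close>, and the scheme-theoretic orbit of a \<open>\<^bold>k\<close>-point \<open>x\<close> (the image of
  \<open>g \<mapsto> g \<cdot> x\<close>) corresponds to the \<open>GL\<^sub>n(K)\<close>-orbit of \<open>x\<close>.
  Distinct \<open>GL(V)\<close>-orbits of \<open>\<^bold>k\<close>-points can have the same scheme-theoretic orbit: over the
  rationals there are infinitely many quadratic fields, hence infinitely many orbits of \<open>\<^bold>k\<close>-points
  for \<open>n = 2\<close>. So finiteness and openness are properties of scheme-theoretic orbits, while the
  classification by isomorphism classes is one of orbits of \<open>\<^bold>k\<close>-points.
\<close>

abbreviation U_Comm_geom :: "nat \<Rightarrow> ('k::field alg_closure) strconst set" where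
  "U_Comm_geom n \<equiv> U_Comm (module_vec TYPE('k alg_closure) n) (unit_vec n) n"

definition orbit_geom :: "nat \<Rightarrow> 'k::field strconst \<Rightarrow> 'k alg_closure strconst set" where
  "orbit_geom n x =
     orbit (module_vec TYPE('k alg_closure) n) (unit_vec n) n (\<lambda>i j l. to_ac (x i j l))"

end

theory Submission
  imports Defs
begin

text \<open>
  A commutative associative product lies in the nondegenerate locus iff its algebra is unital and
  reduced. If the trace form is nondegenerate, the element representing the trace functional is an
  identity, and \<open>a\<^sup>2 = 0\<close> makes every multiplication by a multiple of \<open>a\<close> square to zero, hence
  traceless, so that \<open>a = 0\<close>. Conversely a reduced finite-dimensional algebra is von Neumann regular,
  so a nonzero element of the radical of the trace form would have a nonzero idempotent multiple of
  trace \<open>0\<close>; but the trace of an idempotent is its rank, and the characteristic is \<open>0\<close>.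

  Reduced algebras are cut by a maximal family of orthogonal idempotents into fields, which are
  separable in characteristic \<open>0\<close>; over an algebraically closed field each of them is the base field, and the
  idempotents form a basis with the structure constants of the coordinatewise algebra. Hence all
  points over the algebraic closure lie in one orbit, the nonvanishing locus of the discriminant,
  while over \<open>\<^bold>k\<close> two points lie in the same orbit iff their algebras are isomorphic.
\<close>

section \<open>Linear algebra with indexed bases\<close>

text \<open>The field \<open>one\<close> of \<open>alg_of\<close> is a definite description, so the
  product on \<open>V\<close> gives an algebra only after an identity is known; up to that point the
  arguments run on the bilinear map \<open>mu\<close>. The structure theory rests on one polynomial
  relation: the powers of \<open>a\<close> are linearly dependent, and reducedness allows factors of
  \<open>a\<close> to be cancelled from the relation until its constant term is nonzero. This yields
  an idempotent multiple of every nonzero element, without chain conditions or prime ideals.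
  Idempotent families are taken of greatest length rather than maximal for inclusion, because
  primitivity is tested by replacing a member by two others. Finiteness and openness concern
  geometric orbits, so the discriminant is rewritten as a polynomial in the structure constants that
  mentions neither \<open>V\<close> nor \<open>e\<close>; this form survives the passage to the
  algebraic closure.\<close>

definition lc :: "('k::field, 'v) module \<Rightarrow> (nat \<Rightarrow> 'v) \<Rightarrow> nat \<Rightarrow> (nat \<Rightarrow> 'k) \<Rightarrow> 'v" where
  "lc V b n c = (\<Oplus>\<^bsub>V\<^esub>i\<in>{..<n}. c i \<odot>\<^bsub>V\<^esub> b i)"

text \<open>Indexing by an initial segment, in place of a set of vectors, allows repeated vectors
  and induction on the length. Only coefficients below \<open>n\<close> are constrained, since
  \<open>lc\<close> ignores the others.\<close>

definition indep :: "('k::field, 'v) module \<Rightarrow> (nat \<Rightarrow> 'v) \<Rightarrow> nat \<Rightarrow> bool" where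
  "indep V b n \<longleftrightarrow> (\<forall>c. lc V b n c = \<zero>\<^bsub>V\<^esub> \<longrightarrow> (\<forall>i<n. c i = 0))"

abbreviation lin_map :: "('k::field, 'v) module \<Rightarrow> ('k, 'w) module \<Rightarrow> ('v \<Rightarrow> 'w) set" where
  "lin_map V W \<equiv> LinearCombinations.module_hom class_ring V W"

text \<open>The scalar ring is fixed to \<open>class_ring\<close>, whose carrier is the whole type:
  the scalar laws can be restated in type-class arithmetic, with no membership premises on
  scalars.\<close>

locale vspace = vectorspace class_ring V for V :: "('k::field, 'v) module" (structure)
begin

lemma smult_in [simp, intro]: "x \<in> carrier V \<Longrightarrow> c \<odot> x \<in> carrier V"
  using smult_closed[of c x] by simp

lemma smult_add_left: "x \<in> carrier V \<Longrightarrow> (a + b) \<odot> x = a \<odot> x \<oplus> b \<odot> x"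
  using smult_l_distr[of a b x] by simp

lemma smult_add_right: "x \<in> carrier V \<Longrightarrow> y \<in> carrier V \<Longrightarrow> a \<odot> (x \<oplus> y) = a \<odot> x \<oplus> a \<odot> y"
  using smult_r_distr[of a x y] by simp

lemma smult_mult: "x \<in> carrier V \<Longrightarrow> (a * b) \<odot> x = a \<odot> (b \<odot> x)"
  using smult_assoc1[of a b x] by simp

lemma smult_1 [simp]: "x \<in> carrier V \<Longrightarrow> 1 \<odot> x = x"
  using smult_one[of x] by simp

lemma smult_0 [simp]: "x \<in> carrier V \<Longrightarrow> 0 \<odot> x = \<zero>"
  using smult_l_null[of x] by simp

lemma smult_zero [simp]: "c \<odot> \<zero> = \<zero>"
  using smult_r_null[of c] by simp

lemma smult_neg: "x \<in> carrier V \<Longrightarrow> (- a) \<odot> x = \<ominus> (a \<odot> x)"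
  using smult_l_minus[of a x] by (simp add: class_ring_simps)

lemma lc_empty [simp]: "lc V b 0 c = \<zero>"
  unfolding lc_def by simp

lemma lc_Suc: "(\<And>i. i \<le> n \<Longrightarrow> b i \<in> carrier V) \<Longrightarrow> lc V b (Suc n) c = lc V b n c \<oplus> c n \<odot> b n"
  unfolding lc_def lessThan_Suc
  by (subst finsum_insert) (auto simp: Pi_def a_comm)

lemma lc_closed [simp, intro]: "(\<And>i. i < n \<Longrightarrow> b i \<in> carrier V) \<Longrightarrow> lc V b n c \<in> carrier V"
  unfolding lc_def by (auto intro!: finsum_closed)

lemma lc_cong:
  assumes "\<And>i. i < n \<Longrightarrow> b i \<in> carrier V" "\<And>i. i < n \<Longrightarrow> b i = b' i" "\<And>i. i < n \<Longrightarrow> c i = c' i"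
  shows "lc V b n c = lc V b' n c'"
  unfolding lc_def using assms by (intro finsum_cong') (auto simp: Pi_def)

lemma lc_add:
  "(\<And>i. i < n \<Longrightarrow> b i \<in> carrier V) \<Longrightarrow> lc V b n (\<lambda>i. c i + d i) = lc V b n c \<oplus> lc V b n d"
  by (induction n) (simp_all add: lc_Suc smult_add_left a_ac)

lemma lc_smult:
  "(\<And>i. i < n \<Longrightarrow> b i \<in> carrier V) \<Longrightarrow> lc V b n (\<lambda>i. a * c i) = a \<odot> lc V b n c"
  by (induction n) (simp_all add: lc_Suc smult_add_right smult_mult)

lemma lc_zero:
  "(\<And>i. i < n \<Longrightarrow> b i \<in> carrier V) \<Longrightarrow> (\<And>i. i < n \<Longrightarrow> c i = 0) \<Longrightarrow> lc V b n c = \<zero>"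
  by (induction n) (simp_all add: lc_Suc)

lemma lc_delta:
  assumes "\<And>i. i < n \<Longrightarrow> b i \<in> carrier V" "i < n" 
  shows "lc V b n (\<lambda>j. if j = i then a else 0) = a \<odot> b i"
  using assms
proof (induction n)
  case (Suc n)
  show ?case
  proof (cases "i = n")
    case True
    have "lc V b n (\<lambda>j. if j = n then a else 0) = \<zero>"
      using Suc.prems by (intro lc_zero) auto
    then show ?thesis using True Suc.prems by (simp add: lc_Suc)
  next
    case False
    then show ?thesis using Suc by (simp add: lc_Suc)
  qed
qed simp

lemma lc_sum:
  fixes m :: nat
  assumes "\<And>i. i < n \<Longrightarrow> b i \<in> carrier V"
  shows "(\<Oplus>j\<in>{..<m}. lc V b n (c j)) = lc V b n (\<lambda>i. \<Sum>j<m. c j i)"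
proof (induction m)
  case (Suc m)
  have "(\<Oplus>j\<in>{..<Suc m}. lc V b n (c j)) = lc V b n (c m) \<oplus> (\<Oplus>j\<in>{..<m}. lc V b n (c j))"
    unfolding lessThan_Suc using assms by (subst finsum_insert) auto
  then show ?case using assms Suc by (simp add: lc_add a_comm)
qed (use assms in \<open>simp add: lc_zero\<close>)

text \<open>Substituting combinations into a combination multiplies the coefficient
  matrices.\<close>

lemma lc_lc:
  assumes b: "\<And>i. i < n \<Longrightarrow> b i \<in> carrier V" and w: "\<And>j. j < m \<Longrightarrow> w j = lc V b n (a j)"
  shows "lc V w m c = lc V b n (\<lambda>i. \<Sum>j<m. c j * a j i)"
  using w
proof (induction m)
  case (Suc m)
  have w': "w i \<in> carrier V" if "i \<le> m" for i
    using Suc.prems[of i] that b by (simp add: lc_closed)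
  have "lc V w (Suc m) c = lc V b n (\<lambda>i. \<Sum>j<m. c j * a j i) \<oplus> c m \<odot> w m"
    using Suc w' by (simp add: lc_Suc)
  also have "c m \<odot> w m = lc V b n (\<lambda>i. c m * a m i)"
    using Suc.prems[of m] b by (simp add: lc_smult)
  also have "lc V b n (\<lambda>i. \<Sum>j<m. c j * a j i) \<oplus> \<dots> = lc V b n (\<lambda>i. \<Sum>j<Suc m. c j * a j i)"
    using b by (simp add: lc_add)
  finally show ?case .
qed (use b in \<open>simp add: lc_zero\<close>)

lemma indep_inj:
  assumes "indep V b n" "\<And>i. i < n \<Longrightarrow> b i \<in> carrier V"
  shows "inj_on b {..<n}"
proof (rule inj_onI, rule ccontr)
  fix i j assume ij: "i \<in> {..<n}" "j \<in> {..<n}" "b i = b j" "i \<noteq> j"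
  let ?d = "\<lambda>i k. if k = i then 1 else (0::'k)"
  let ?c = "\<lambda>k. ?d i k + (if k = j then - 1 else 0)"
  have "lc V b n ?c = 1 \<odot> b i \<oplus> (- 1) \<odot> b j"
    using ij assms(2) by (simp only: lc_add lc_delta lessThan_iff)
  then have "lc V b n ?c = \<zero>"
    using ij assms(2)[of j] by (simp add: smult_neg r_neg)
  then have "?c i = 0"
    using assms(1) ij unfolding indep_def lessThan_iff by blast
  then show False using ij by simp
qed

lemma indep_lc_eqD:
  assumes "indep V b n" "\<And>i. i < n \<Longrightarrow> b i \<in> carrier V" "lc V b n c = lc V b n d" "i < n"
  shows "c i = d i"
proof -
  have "lc V b n (\<lambda>i. c i + - 1 * d i) = lc V b n c \<oplus> (- 1) \<odot> lc V b n d"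
    using assms(2) by (simp only: lc_add lc_smult)
  also have "\<dots> = \<zero>" using assms(2,3) by (simp add: smult_neg r_neg)
  finally have "c i + - 1 * d i = 0" using assms(1,4) unfolding indep_def by blast
  then show ?thesis by simp
qed

lemma lincomb_image:
  assumes "inj_on b {..<n}" "\<And>i. i < n \<Longrightarrow> b i \<in> carrier V"
  shows "lincomb a (b ` {..<n}) = lc V b n (\<lambda>i. a (b i))"
  unfolding lincomb_def lc_def using assms by (subst finsum_reindex) (auto simp: Pi_def)

lemma indep_iff_lin_indpt:
  assumes "inj_on b {..<n}" "\<And>i. i < n \<Longrightarrow> b i \<in> carrier V"
  shows "indep V b n \<longleftrightarrow> \<not> lin_dep (b ` {..<n})"
proof
  assume i: "indep V b n"
  show "\<not> lin_dep (b ` {..<n})"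
  proof (rule finite_lin_indpt2)
    fix a assume "lincomb a (b ` {..<n}) = \<zero>"
    then have "lc V b n (\<lambda>i. a (b i)) = \<zero>"
      by (simp only: lincomb_image[OF assms])
    then have "\<forall>i<n. a (b i) = 0"
      using i[unfolded indep_def, rule_format, of "\<lambda>i. a (b i)"] by blast
    then show "\<forall>v\<in>b ` {..<n}. a v = \<zero>\<^bsub>class_ring\<^esub>"
      by auto
  qed (use assms in auto)
next
  assume l: "\<not> lin_dep (b ` {..<n})"
  show "indep V b n"
    unfolding indep_def
  proof (intro allI impI, rule ccontr)
    fix c i assume c: "lc V b n c = \<zero>" "i < n" "c i \<noteq> 0"
    \<comment> \<open>Coefficients attached to indices become coefficients attached to vectors;
      injectivity of \<open>b\<close> makes this possible.\<close>
    let ?a = "\<lambda>v. c (the_inv_into {..<n} b v)"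
    have "lincomb ?a (b ` {..<n}) = lc V b n c"
      using assms by (subst lincomb_image[OF assms]) (auto intro!: lc_cong simp: the_inv_into_f_f)
    then have "lin_dep (b ` {..<n})"
      using c assms by (intro lin_dep_crit[where a = ?a and A = "b ` {..<n}" and v = "b i"])
        (auto simp: the_inv_into_f_f)
    then show False using l by simp
  qed
qed

lemma gen_set_iff:
  assumes "inj_on b {..<n}" "\<And>i. i < n \<Longrightarrow> b i \<in> carrier V"
  shows "span (b ` {..<n}) = carrier V \<longleftrightarrow> (\<forall>v\<in>carrier V. \<exists>c. v = lc V b n c)"
proof -
  have sub: "b ` {..<n} \<subseteq> carrier V" using assms by auto
  have "span (b ` {..<n}) = {lc V b n c | c. True}"
  proof -
    have "\<exists>a. lc V b n c = lincomb a (b ` {..<n})" for c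
      using assms
      by (intro exI[of _ "\<lambda>v. c (the_inv_into {..<n} b v)"], subst lincomb_image)
        (auto intro!: lc_cong simp: the_inv_into_f_f)
    moreover have "\<exists>c. lincomb a (b ` {..<n}) = lc V b n c" for a
      using lincomb_image[OF assms] by blast
    ultimately have "{lincomb a (b ` {..<n}) | a. a \<in> b ` {..<n} \<rightarrow> carrier class_ring} = {lc V b n c | c. True}"
      by (simp add: Pi_def) metis
    then show ?thesis using finite_span[OF _ sub] by simp
  qed
  then show ?thesis using assms by auto
qed

lemma ordered_basis_iff:
  "ordered_basis V b n \<longleftrightarrow>
     (\<forall>i<n. b i \<in> carrier V) \<and> indep V b n \<and> (\<forall>v\<in>carrier V. \<exists>c. v = lc V b n c)"
  (is "?L \<longleftrightarrow> ?R")
proof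
  assume l: ?L
  then have "inj_on b {..<n}" "\<And>i. i < n \<Longrightarrow> b i \<in> carrier V"
    unfolding ordered_basis_def basis_def by auto
  then show ?R using l indep_iff_lin_indpt[of b n] gen_set_iff[of b n]
    unfolding ordered_basis_def basis_def by auto
next
  assume r: ?R
  then have i: "inj_on b {..<n}" using indep_inj by auto
  then show ?L using r indep_iff_lin_indpt[of b n] gen_set_iff[of b n] vectorspace_axioms
    unfolding ordered_basis_def basis_def by auto
qed

lemma ordered_basis_dim: "ordered_basis V b n \<Longrightarrow> fin_dim \<and> dim = n"
  unfolding ordered_basis_def
  using dim_basis[of "b ` {..<n}"] by (auto simp: card_image fin_dim_def basis_def)

lemma exists_ordered_basis:
  assumes "fin_dim"
  shows "\<exists>b. ordered_basis V b dim"
proof -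
  obtain B where B: "finite B" "basis B" using finite_basis_exists assms by blast
  obtain b where "bij_betw b {..<card B} B"
    using ex_bij_betw_nat_finite[OF B(1)] by (auto simp: atLeast0LessThan)
  then have "ordered_basis V b (card B)"
    using B vectorspace_axioms unfolding ordered_basis_def bij_betw_def by auto
  then show ?thesis using ordered_basis_dim by metis
qed

lemma lc_in_span:
  assumes S: "S \<subseteq> carrier V" and b: "\<And>i. i < n \<Longrightarrow> b i \<in> span S"
  shows "lc V b n c \<in> span S"
  using b
proof (induction n)
  case 0
  then show ?case using span_zero[of S] by simp
next
  case (Suc n)
  have "c n \<odot> b n \<in> span S"
    using submodule.smult_closed[OF span_is_submodule[OF S]] Suc.prems by simp
  moreover have "b i \<in> carrier V" if "i \<le> n" for i
    using span_closed[OF S] Suc.prems that by simp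
  ultimately show ?case
    using Suc span_add1[OF S] by (simp add: lc_Suc)
qed

lemma fin_dimI:
  assumes "\<And>i. i < m \<Longrightarrow> w i \<in> carrier V" "\<And>v. v \<in> carrier V \<Longrightarrow> \<exists>c. v = lc V w m c"
  shows "fin_dim"
proof -
  let ?S = "w ` {..<m}"
  have S: "?S \<subseteq> carrier V" using assms by auto
  have "lc V w m c \<in> span ?S" for c
    by (rule lc_in_span[OF S], rule span_mem) (use S in auto)
  then have "span ?S = carrier V"
    using assms(2) span_is_subset2[OF S] by blast
  then show ?thesis using S unfolding fin_dim_def by blast
qed

lemma indep_le_dim:
  assumes "fin_dim" "indep V w m" "\<And>i. i < m \<Longrightarrow> w i \<in> carrier V"
  shows "m \<le> dim"
proof -
  have i: "inj_on w {..<m}" using indep_inj assms by auto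
  then have "card (w ` {..<m}) \<le> dim"
    using assms indep_iff_lin_indpt[OF i] by (intro li_le_dim) auto
  then show ?thesis using i by (simp add: card_image)
qed

text \<open>A basis of the span of \<open>S\<close> chosen inside \<open>S\<close>: the dimension
  bounds the length of independent families in \<open>S\<close>, and a longest one cannot be
  extended by any \<open>v\<close> in \<open>S\<close>, which forces a relation involving
  \<open>v\<close>.\<close>

lemma maximal_indep:
  assumes "fin_dim" "S \<subseteq> carrier V"
  shows "\<exists>r w. (\<forall>i<r. w i \<in> S) \<and> indep V w r \<and> (\<forall>v\<in>S. \<exists>c. v = lc V w r c)"
proof -
  define P where "P r \<longleftrightarrow> (\<exists>w. (\<forall>i<r. w i \<in> S) \<and> indep V w r)" for r :: nat
  have P0: "P 0" unfolding P_def indep_def by auto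
  have bd: "r \<le> dim" if r: "P r" for r
  proof -
    obtain w where "\<forall>i<r. w i \<in> S" "indep V w r" using r unfolding P_def by blast
    then show ?thesis using assms by (intro indep_le_dim[of w r]) auto
  qed
  define r where "r = Greatest P"
  have r: "P r" "\<And>s. P s \<Longrightarrow> s \<le> r"
    unfolding r_def using GreatestI_nat[of P 0 dim, OF P0 bd] Greatest_le_nat[of P _ dim, OF _ bd] by auto
  then obtain w where w: "\<forall>i<r. w i \<in> S" "indep V w r" unfolding P_def by blast
  have wc: "w i \<in> carrier V" if "i < r" for i using w assms that by auto
  show ?thesis
  proof (rule exI[of _ r], rule exI[of _ w], intro conjI ballI)
    fix v assume v: "v \<in> S"
    then have vc: "v \<in> carrier V" using assms by auto
    let ?w = "\<lambda>i. if i < r then w i else v"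
    have nP: "\<not> P (Suc r)" using r(2)[of "Suc r"] by auto
    have wS: "\<forall>i<Suc r. ?w i \<in> S" using w v by auto
    have "\<not> indep V ?w (Suc r)"
      using nP wS unfolding P_def not_ex by (elim allE[of _ ?w]) blast
    then obtain c j where c: "lc V ?w (Suc r) c = \<zero>" "j < Suc r" "c j \<noteq> 0"
      unfolding indep_def by auto
    have e: "lc V ?w (Suc r) c = lc V w r c \<oplus> c r \<odot> v"
      using wc vc lc_cong[of r w ?w c c] by (simp add: lc_Suc)
    \<comment> \<open>With \<open>c r = 0\<close> the relation would hold among the
      \<open>w i\<close> alone and be trivial. Hence it can be solved for \<open>v\<close>.\<close>
    have cr: "c r \<noteq> 0"
    proof
      assume c0: "c r = 0"
      then have "lc V w r c = \<zero>" using e c vc wc by simp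
      then have "\<forall>i<r. c i = 0" using w(2) unfolding indep_def by blast
      then have "c j = 0" using c(2) c0 by (cases "j = r") auto
      then show False using c by simp
    qed
    let ?d = "- inverse (c r)"
    have "c r \<odot> v = \<ominus> lc V w r c"
      using e c(1) vc wc minus_equality[of "c r \<odot> v" "lc V w r c"] by (simp add: a_comm)
    then have "inverse (c r) \<odot> (c r \<odot> v) = inverse (c r) \<odot> (\<ominus> lc V w r c)" by simp
    then have "v = inverse (c r) \<odot> ((- 1) \<odot> lc V w r c)"
      using cr vc wc by (simp add: smult_mult[symmetric] smult_neg)
    then have "v = lc V w r (\<lambda>i. inverse (c r) * (- 1 * c i))"
      using wc by (simp only: lc_smult)
    then show "\<exists>c. v = lc V w r c" by blast
  qed (use w in auto)
qed

end

lemma ordered_basis_vspace: "ordered_basis V e n \<Longrightarrow> vspace V"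
  unfolding ordered_basis_def vspace_def by simp

locale based = vspace V for V :: "('k::field, 'v) module" (structure) and e :: "nat \<Rightarrow> 'v" and n :: nat +
  assumes basis: "ordered_basis V e n"
begin

lemma e_in [simp, intro]: "i < n \<Longrightarrow> e i \<in> carrier V"
  using basis ordered_basis_iff by blast

lemma e_indep: "indep V e n"
  using basis ordered_basis_iff by blast

lemma fin_dim: "fin_dim" and dim_eq: "dim = n"
  using basis ordered_basis_dim by auto

lemma lc_inj: "lc V e n c = lc V e n d \<Longrightarrow> i < n \<Longrightarrow> c i = d i"
  using indep_lc_eqD[OF e_indep] by blast

text \<open>The clause on indices \<open>\<ge> n\<close> makes the coefficient function itself
  unique, not only its values below \<open>n\<close>; this is what the definite description in
  \<open>coord\<close> rests on.\<close>

lemma coord_unique: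
  assumes "v \<in> carrier V"
  shows "\<exists>!c. (\<forall>i\<ge>n. c i = 0) \<and> v = lc V e n c"
proof -
  obtain c where c: "v = lc V e n c" using assms basis ordered_basis_iff by blast
  let ?c = "\<lambda>i. if i < n then c i else 0"
  show ?thesis
  proof (rule ex1I[of _ ?c])
    show "(\<forall>i\<ge>n. ?c i = 0) \<and> v = lc V e n ?c"
      using c by (auto intro!: lc_cong)
    fix d assume "(\<forall>i\<ge>n. d i = 0) \<and> v = lc V e n d"
    then show "d = ?c" using c lc_inj[of c d] by (auto simp: fun_eq_iff)
  qed
qed

lemma coord_props: "v \<in> carrier V \<Longrightarrow> (\<forall>i\<ge>n. coord V e n v i = 0) \<and> v = lc V e n (coord V e n v)"
  unfolding coord_def lc_def[symmetric] by (rule theI'[OF coord_unique])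

lemma lc_coord: "v \<in> carrier V \<Longrightarrow> lc V e n (coord V e n v) = v"
  using coord_props[of v] by (metis (no_types))

lemma coord_lc: "i < n \<Longrightarrow> coord V e n (lc V e n c) i = c i"
  using lc_inj[of "coord V e n (lc V e n c)" c] by (simp add: lc_coord)

lemma coord_out: "v \<in> carrier V \<Longrightarrow> n \<le> i \<Longrightarrow> coord V e n v i = 0"
  using coord_props by blast

lemma coord_add:
  assumes "u \<in> carrier V" "v \<in> carrier V"
  shows "coord V e n (u \<oplus> v) i = coord V e n u i + coord V e n v i"
proof (cases "i < n")
  case True
  have "u \<oplus> v = lc V e n (\<lambda>i. coord V e n u i + coord V e n v i)"
    using assms by (simp add: lc_add lc_coord)
  then show ?thesis using True by (simp add: coord_lc)
qed (use assms in \<open>simp add: coord_out\<close>)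

lemma coord_smult:
  assumes "v \<in> carrier V"
  shows "coord V e n (c \<odot> v) i = c * coord V e n v i"
proof (cases "i < n")
  case True
  have "c \<odot> v = lc V e n (\<lambda>i. c * coord V e n v i)"
    using assms by (simp add: lc_smult lc_coord)
  then show ?thesis using True by (simp add: coord_lc)
qed (use assms in \<open>simp add: coord_out\<close>)

lemma coord_e: "i < n \<Longrightarrow> j < n \<Longrightarrow> coord V e n (e i) j = (if j = i then 1 else 0)"
  using coord_lc[of j "\<lambda>j. if j = i then 1 else 0"] by (simp add: lc_delta)

lemma coord_eqI:
  assumes "u \<in> carrier V" "v \<in> carrier V" "\<And>i. i < n \<Longrightarrow> coord V e n u i = coord V e n v i"
  shows "u = v"
  using lc_cong[of n e e "coord V e n u" "coord V e n v"] assms(3)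
  by (simp add: lc_coord assms(1,2))

lemma coord_zero: "coord V e n \<zero> i = 0"
  using coord_smult[of \<zero> 0 i] by simp

lemma coord_lc': 
  assumes "\<And>j. j < m \<Longrightarrow> w j \<in> carrier V"
  shows "coord V e n (lc V w m c) i = (\<Sum>j<m. c j * coord V e n (w j) i)"
  using assms by (induction m) (simp_all add: lc_Suc coord_add coord_smult coord_zero)

end

lemma ordered_basis_based: "ordered_basis V e n \<longleftrightarrow> based V e n"
  unfolding based_def based_axioms_def by (auto dest: ordered_basis_vspace)

lemma lin_map_lc:
  assumes "vspace V" "vspace W" "f \<in> lin_map V W" "\<And>i. i < n \<Longrightarrow> b i \<in> carrier V"
  shows "f (lc V b n c) = lc W (\<lambda>i. f (b i)) n c"
proof -
  interpret V: vspace V by fact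
  interpret W: vspace W by fact
  have cl: "f v \<in> carrier W" if "v \<in> carrier V" for v
    using LinearCombinations.module_hom_closed[OF assms(3)] that by auto
  have z: "f \<zero>\<^bsub>V\<^esub> = \<zero>\<^bsub>W\<^esub>"
    using LinearCombinations.module_hom_smult[OF assms(3), of 0 "\<zero>\<^bsub>V\<^esub>"] cl[of "\<zero>\<^bsub>V\<^esub>"] by simp
  show ?thesis using assms(4)
  proof (induction n)
    case (Suc n)
    then show ?case using cl LinearCombinations.module_hom_add[OF assms(3)] LinearCombinations.module_hom_smult[OF assms(3)]
      by (simp add: V.lc_Suc W.lc_Suc)
  qed (simp add: z)
qed

section \<open>Products given by structure constants\<close>

text \<open>The trace of multiplication by the product of \<open>e i\<close> and \<open>e j\<close>,
  written in the structure constants alone; the inner sum is the trace of multiplication by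
  \<open>e l\<close>. With neither \<open>V\<close> nor \<open>e\<close> in it, the formula can be
  compared across fields and is visibly a polynomial.\<close>

definition trace_form :: "nat \<Rightarrow> ('k::field) strconst \<Rightarrow> nat \<Rightarrow> nat \<Rightarrow> 'k" where
  "trace_form n x i j = (\<Sum>l<n. x i j l * (\<Sum>m<n. x l m m))"

abbreviation gram :: "nat \<Rightarrow> ('k::field) strconst \<Rightarrow> 'k mat" where
  "gram n x \<equiv> mat n n (\<lambda>(i, j). trace_form n x i j)"

context based
begin

abbreviation cd :: "'v \<Rightarrow> nat \<Rightarrow> 'k" where "cd \<equiv> coord V e n"

lemma mu_lc: "mu V e n x u v = lc V e n (\<lambda>l. \<Sum>i<n. \<Sum>j<n. cd u i * cd v j * x i j l)"
  unfolding mu_def by (simp add: lc_def[symmetric] lc_sum)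

lemma mu_closed [simp, intro]: "mu V e n x u v \<in> carrier V"
  unfolding mu_lc by auto

lemma coord_mu: "l < n \<Longrightarrow> cd (mu V e n x u v) l = (\<Sum>i<n. \<Sum>j<n. cd u i * cd v j * x i j l)"
  unfolding mu_lc by (rule coord_lc)

lemma coord_mu_e:
  assumes "i < n" "j < n" "l < n"
  shows "cd (mu V e n x (e i) (e j)) l = x i j l"
proof -
  have "cd (mu V e n x (e i) (e j)) l = (\<Sum>a<n. \<Sum>b<n. if a = i \<and> b = j then x a b l else 0)"
    unfolding coord_mu[OF assms(3)] by (intro sum.cong refl) (use assms in \<open>simp add: coord_e\<close>)
  also have "\<dots> = (\<Sum>a<n. if a = i then x a j l else 0)"
    by (intro sum.cong refl) (use assms in auto)
  finally show ?thesis using assms by simp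
qed

lemma mu_lin_right: "mu V e n x u \<in> lin_map V V"
  unfolding LinearCombinations.module_hom_def
  by (auto intro!: coord_eqI simp: coord_mu coord_add coord_smult algebra_simps sum.distrib sum_distrib_left)

lemma mu_lin_left: "(\<lambda>u. mu V e n x u v) \<in> lin_map V V"
  unfolding LinearCombinations.module_hom_def
  by (auto intro!: coord_eqI simp: coord_mu coord_add coord_smult algebra_simps sum.distrib sum_distrib_left)

lemma mu_add_left: "u \<in> carrier V \<Longrightarrow> v \<in> carrier V \<Longrightarrow>
    mu V e n x (u \<oplus> v) w = mu V e n x u w \<oplus> mu V e n x v w"
  using LinearCombinations.module_hom_add[OF mu_lin_left] by blast

lemma mu_smult_left: "u \<in> carrier V \<Longrightarrow> mu V e n x (c \<odot> u) w = c \<odot> mu V e n x u w"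
  using LinearCombinations.module_hom_smult[OF mu_lin_left, of c] by simp

lemma mu_determines:
  assumes "x \<in> strconsts n" "y \<in> strconsts n"
    "\<And>i j. i < n \<Longrightarrow> j < n \<Longrightarrow> mu V e n x (e i) (e j) = mu V e n y (e i) (e j)"
  shows "x = y"
proof (intro ext)
  fix i j l
  show "x i j l = y i j l"
  proof (cases "i < n \<and> j < n \<and> l < n")
    case True
    then show ?thesis using assms(3)[of i j] coord_mu_e[of i j l] by metis
  qed (use assms in \<open>auto simp: strconsts_def\<close>)
qed

lemma lin_map_eqI:
  assumes "vspace W" "f \<in> lin_map V W" "g \<in> lin_map V W" "\<And>i. i < n \<Longrightarrow> f (e i) = g (e i)" "v \<in> carrier V"
  shows "f v = g v"
proof -
  interpret W: vspace W by fact
  have "f v = lc W (\<lambda>i. f (e i)) n (cd v)"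
    using lin_map_lc[OF vspace_axioms assms(1,2), of n e "cd v"] assms(5) by (simp add: lc_coord)
  also have "\<dots> = lc W (\<lambda>i. g (e i)) n (cd v)"
    using funcset_mem[OF LinearCombinations.module_hom_closed[OF assms(3)]] assms(4)
    by (intro W.lc_cong) auto
  also have "\<dots> = g v"
    using lin_map_lc[OF vspace_axioms assms(1,3), of n e "cd v"] assms(5) by (simp add: lc_coord)
  finally show ?thesis .
qed

lemma mu_commute_iff:
  "(\<forall>u\<in>carrier V. \<forall>v\<in>carrier V. mu V e n x u v = mu V e n x v u) \<longleftrightarrow>
     (\<forall>i<n. \<forall>j<n. \<forall>l<n. x i j l = x j i l)" (is "?L \<longleftrightarrow> ?R")
proof
  assume ?L then show ?R by (metis coord_mu_e e_in)
next
  assume r: ?R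
  have 1: "mu V e n x (e i) (e j) = mu V e n x (e j) (e i)" if "i < n" "j < n" for i j
    using r that by (intro coord_eqI) (auto simp: coord_mu_e)
  have 2: "mu V e n x (e i) v = mu V e n x v (e i)" if "i < n" "v \<in> carrier V" for i v
    by (rule lin_map_eqI[OF vspace_axioms mu_lin_right mu_lin_left]) (use that 1 in auto)
  show ?L
    by (intro ballI, rule lin_map_eqI[OF vspace_axioms mu_lin_left mu_lin_right]) (use 2 in auto)
qed

lemma lin_map_comp:
  assumes "f \<in> lin_map U V" "g \<in> lin_map V W"
  shows "(\<lambda>u. g (f u)) \<in> lin_map U W"
  using assms unfolding LinearCombinations.module_hom_def by (auto simp: Pi_def)

lemma coord_mu_e_left:
  assumes "k < n" "m < n"
  shows "cd (mu V e n x (mu V e n x (e i) (e j)) (e k)) m = (\<Sum>l<n. cd (mu V e n x (e i) (e j)) l * x l k m)"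
proof -
  have "mu V e n x (lc V e n c) (e k) = lc V (\<lambda>l. mu V e n x (e l) (e k)) n c" for c
    using lin_map_lc[OF vspace_axioms vspace_axioms mu_lin_left] by blast
  from this[of "cd (mu V e n x (e i) (e j))"] show ?thesis
    using assms by (simp add: lc_coord coord_lc' coord_mu_e)
qed

lemma coord_mu_e_right:
  assumes "i < n" "m < n"
  shows "cd (mu V e n x (e i) (mu V e n x (e j) (e k))) m = (\<Sum>l<n. cd (mu V e n x (e j) (e k)) l * x i l m)"
proof -
  have "mu V e n x (e i) (lc V e n c) = lc V (\<lambda>l. mu V e n x (e i) (e l)) n c" for c
    using lin_map_lc[OF vspace_axioms vspace_axioms mu_lin_right] by blast
  from this[of "cd (mu V e n x (e j) (e k))"] show ?thesis
    using assms by (simp add: lc_coord coord_lc' coord_mu_e)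
qed

lemma mu_assoc_iff:
  "(\<forall>u\<in>carrier V. \<forall>v\<in>carrier V. \<forall>w\<in>carrier V.
      mu V e n x (mu V e n x u v) w = mu V e n x u (mu V e n x v w)) \<longleftrightarrow>
   (\<forall>i<n. \<forall>j<n. \<forall>k<n. \<forall>m<n. (\<Sum>l<n. x i j l * x l k m) = (\<Sum>l<n. x j k l * x i l m))"
  (is "?L \<longleftrightarrow> ?R")
proof -
  let ?m = "mu V e n x"
  have e: "(?m (?m (e i) (e j)) (e k) = ?m (e i) (?m (e j) (e k))) \<longleftrightarrow>
      (\<forall>m<n. (\<Sum>l<n. x i j l * x l k m) = (\<Sum>l<n. x j k l * x i l m))"
    if "i < n" "j < n" "k < n" for i j k
  proof -
    have l: "cd (?m (?m (e i) (e j)) (e k)) m = (\<Sum>l<n. x i j l * x l k m)" if "m < n" for m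
      using \<open>i < n\<close> \<open>j < n\<close> \<open>k < n\<close> that by (simp add: coord_mu_e_left coord_mu_e)
    have r: "cd (?m (e i) (?m (e j) (e k))) m = (\<Sum>l<n. x j k l * x i l m)" if "m < n" for m
      using \<open>i < n\<close> \<open>j < n\<close> \<open>k < n\<close> that by (simp add: coord_mu_e_right coord_mu_e)
    show ?thesis
    proof
      assume "?m (?m (e i) (e j)) (e k) = ?m (e i) (?m (e j) (e k))"
      then show "\<forall>m<n. (\<Sum>l<n. x i j l * x l k m) = (\<Sum>l<n. x j k l * x i l m)"
        using l r by simp
    next
      assume "\<forall>m<n. (\<Sum>l<n. x i j l * x l k m) = (\<Sum>l<n. x j k l * x i l m)"
      then show "?m (?m (e i) (e j)) (e k) = ?m (e i) (?m (e j) (e k))"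
        using l r by (intro coord_eqI) auto
    qed
  qed
  show ?thesis
  proof
    assume L: ?L
    have "?m (?m (e i) (e j)) (e k) = ?m (e i) (?m (e j) (e k))" if "i < n" "j < n" "k < n" for i j k
      using L that by blast
    then show ?R using e by blast
  next
    assume R: ?R
    \<comment> \<open>From basis triples to all triples by releasing one argument at a time: both
      sides are linear in the released argument.\<close>
    have 1: "?m (?m (e i) (e j)) (e k) = ?m (e i) (?m (e j) (e k))" if "i < n" "j < n" "k < n" for i j k
      using e[OF that] R that by blast
    have 2: "?m (?m (e i) (e j)) w = ?m (e i) (?m (e j) w)" if "i < n" "j < n" "w \<in> carrier V" for i j w
      by (rule lin_map_eqI[OF vspace_axioms mu_lin_right lin_map_comp[OF mu_lin_right mu_lin_right]])
        (use 1 that in auto)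
    have 3: "?m (?m (e i) v) w = ?m (e i) (?m v w)" if "i < n" "v \<in> carrier V" "w \<in> carrier V" for i v w
      by (rule lin_map_eqI[OF vspace_axioms lin_map_comp[OF mu_lin_right mu_lin_left]
            lin_map_comp[OF mu_lin_left mu_lin_right]]) (use 2 that in auto)
    show ?L
      by (intro ballI, rule lin_map_eqI[OF vspace_axioms lin_map_comp[OF mu_lin_left mu_lin_left]
            mu_lin_left]) (use 3 in auto)
  qed
qed

lemma Comm_iff:
  assumes "x \<in> strconsts n"
  shows "x \<in> Comm n \<longleftrightarrow>
    (\<forall>u\<in>carrier V. \<forall>v\<in>carrier V. \<forall>w\<in>carrier V.
      mu V e n x (mu V e n x u v) w = mu V e n x u (mu V e n x v w)) \<and>
    (\<forall>u\<in>carrier V. \<forall>v\<in>carrier V. mu V e n x u v = mu V e n x v u)"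
  unfolding mu_assoc_iff mu_commute_iff using assms unfolding Comm_def by blast

section \<open>Traces of multiplications and the trace form\<close>

lemma Tr_mu: 
  shows "Tr V e n (mu V e n x u) = (\<Sum>l<n. cd u l * (\<Sum>m<n. x l m m))"
proof -
  have "cd (mu V e n x u (e m)) m = (\<Sum>l<n. cd u l * x l m m)" if "m < n" for m
  proof -
    have "cd (mu V e n x u (e m)) m = (\<Sum>l<n. \<Sum>j<n. if j = m then cd u l * x l m m else 0)"
      unfolding coord_mu[OF that] by (intro sum.cong refl) (use that in \<open>simp add: coord_e\<close>)
    then show ?thesis using that by simp
  qed
  then have "Tr V e n (mu V e n x u) = (\<Sum>m<n. \<Sum>l<n. cd u l * x l m m)"
    unfolding Tr_def by simp
  also have "\<dots> = (\<Sum>l<n. \<Sum>m<n. cd u l * x l m m)" by (rule sum.swap)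
  finally show ?thesis by (simp add: sum_distrib_left)
qed

lemma Tr_mu_mu_e:
  assumes "i < n" "j < n"
  shows "Tr V e n (mu V e n x (mu V e n x (e i) (e j))) = trace_form n x i j"
  unfolding Tr_mu trace_form_def by (intro sum.cong refl) (use assms in \<open>simp add: coord_mu_e\<close>)

lemma Delta_eq: "Delta V e n x = det (gram n x)"
proof -
  have "mat n n (\<lambda>(i, j). Tr V e n (mu V e n x (mu V e n x (e i) (e j)))) = gram n x"
    by (rule eq_matI) (auto simp: Tr_mu_mu_e)
  then show ?thesis unfolding Delta_def by simp
qed

lemma Tr_mu_lc:
  assumes "\<And>j. j < m \<Longrightarrow> w j \<in> carrier V"
  shows "Tr V e n (mu V e n x (lc V w m c)) = (\<Sum>j<m. c j * Tr V e n (mu V e n x (w j)))"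
proof -
  let ?t = "\<lambda>l. \<Sum>m<n. x l m m"
  have "Tr V e n (mu V e n x (lc V w m c)) = (\<Sum>l<n. \<Sum>j<m. c j * (cd (w j) l * ?t l))"
    unfolding Tr_mu using assms by (simp add: coord_lc' sum_distrib_right mult.assoc)
  also have "\<dots> = (\<Sum>j<m. \<Sum>l<n. c j * (cd (w j) l * ?t l))"
    by (rule sum.swap)
  finally show ?thesis unfolding Tr_mu by (simp only: sum_distrib_left)
qed

lemma Tr_mu_mu_e_left:
  assumes "i < n" "u \<in> carrier V"
  shows "Tr V e n (mu V e n x (mu V e n x (e i) u)) = (\<Sum>j<n. trace_form n x i j * cd u j)"
proof -
  have "mu V e n x (e i) u = lc V (\<lambda>j. mu V e n x (e i) (e j)) n (cd u)"
    using lin_map_lc[OF vspace_axioms vspace_axioms mu_lin_right, of n e x "e i" "cd u"] assms(2)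
    by (simp add: lc_coord)
  then have "Tr V e n (mu V e n x (mu V e n x (e i) u)) =
      (\<Sum>j<n. cd u j * Tr V e n (mu V e n x (mu V e n x (e i) (e j))))"
    by (simp add: Tr_mu_lc)
  then show ?thesis using assms(1) by (simp add: Tr_mu_mu_e mult.commute)
qed

lemma gram_mult_vec: 
  assumes "i < n" "u \<in> carrier V" 
  shows "(gram n x *\<^sub>v vec n (cd u)) $ i = Tr V e n (mu V e n x (mu V e n x (e i) u))"
  using assms by (simp add: Tr_mu_mu_e_left scalar_prod_def atLeast0LessThan)

lemma Tr_mu_mu_zeroI:
  assumes "\<And>i. i < n \<Longrightarrow> Tr V e n (mu V e n x (mu V e n x (e i) u)) = 0" "v \<in> carrier V"
  shows "Tr V e n (mu V e n x (mu V e n x v u)) = 0"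
proof -
  have "mu V e n x v u = lc V (\<lambda>j. mu V e n x (e j) u) n (cd v)"
    using lin_map_lc[OF vspace_axioms vspace_axioms mu_lin_left, of n e x "cd v" u] assms(2)
    by (simp add: lc_coord)
  then show ?thesis using assms(1) by (simp add: Tr_mu_lc)
qed

text \<open>A kernel vector of the singular Gram matrix is read as the coordinate vector of an
  element of the radical.\<close>

lemma trace_radical:
  assumes "Delta V e n x = 0"
  shows "\<exists>u\<in>carrier V. u \<noteq> \<zero> \<and> (\<forall>v\<in>carrier V. Tr V e n (mu V e n x (mu V e n x v u)) = 0)"
proof -
  obtain c where c: "c \<in> carrier_vec n" "c \<noteq> 0\<^sub>v n" "gram n x *\<^sub>v c = 0\<^sub>v n"
    using assms det_0_iff_vec_prod_zero[of "gram n x" n] unfolding Delta_eq by auto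
  define u where "u = lc V e n (\<lambda>i. c $ i)"
  have u: "u \<in> carrier V" unfolding u_def by auto
  have cu: "vec n (cd u) = c"
    using c(1) by (auto simp: u_def coord_lc)
  have "u \<noteq> \<zero>"
  proof
    assume "u = \<zero>"
    then have "c = 0\<^sub>v n" using cu by (auto simp: coord_zero)
    then show False using c by simp
  qed
  moreover have "Tr V e n (mu V e n x (mu V e n x (e i) u)) = 0" if "i < n" for i
    using gram_mult_vec[OF that u, of x] that unfolding cu c(3) by simp
  ultimately show ?thesis using Tr_mu_mu_zeroI u by blast
qed

lemma trace_nondegenerate:
  assumes "Delta V e n x \<noteq> 0" "u \<in> carrier V"
    "\<And>v. v \<in> carrier V \<Longrightarrow> Tr V e n (mu V e n x (mu V e n x v u)) = 0"
  shows "u = \<zero>"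
proof -
  have "gram n x *\<^sub>v vec n (cd u) = 0\<^sub>v n"
    using gram_mult_vec[OF _ assms(2), of _ x] assms(3) by (intro eq_vecI) auto
  then have "vec n (cd u) = 0\<^sub>v n"
    using assms(1) det_0_iff_vec_prod_zero[of "gram n x" n] vec_carrier[of n "cd u"]
    unfolding Delta_eq by (metis mat_carrier)
  then have "cd u i = 0" if "i < n" for i
    using that by (metis index_vec index_zero_vec(1))
  then show ?thesis using assms(2) by (intro coord_eqI) (auto simp: coord_zero)
qed

lemma trace_representable:
  assumes "Delta V e n x \<noteq> 0"
  shows "\<exists>u\<in>carrier V. \<forall>v\<in>carrier V. Tr V e n (mu V e n x (mu V e n x v u)) = Tr V e n (mu V e n x v)"
proof -
  let ?G = "gram n x"
  define t where "t = vec n (\<lambda>i. Tr V e n (mu V e n x (e i)))"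
  \<comment> \<open>Cramer's rule: the inverse Gram matrix, as adjugate over determinant, applied to
    the vector \<open>t\<close> of traces of the basis multiplications.\<close>
  define c where "c = inverse (det ?G) \<cdot>\<^sub>v (adj_mat ?G *\<^sub>v t)"
  have G: "?G \<in> carrier_mat n n" by simp
  have t: "t \<in> carrier_vec n" unfolding t_def by simp
  have id: "(a \<cdot>\<^sub>m 1\<^sub>m n) *\<^sub>v t = a \<cdot>\<^sub>v t" for a
    using t by auto
  have "?G *\<^sub>v c = inverse (det ?G) \<cdot>\<^sub>v ((?G * adj_mat ?G) *\<^sub>v t)"
    unfolding c_def using adj_mat(1)[OF G] t
    by (subst mult_mat_vec[of _ n n]) (auto simp: assoc_mult_mat_vec[of _ n n _ n])
  also have "\<dots> = t"
    unfolding adj_mat(2)[OF G] id using assms unfolding Delta_eq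
    by (simp add: smult_smult_assoc)
  finally have Gc: "?G *\<^sub>v c = t" .
  have cn: "c \<in> carrier_vec n" unfolding c_def t_def using adj_mat(1)[OF G] by auto
  define u where "u = lc V e n (\<lambda>i. c $ i)"
  have u: "u \<in> carrier V" unfolding u_def by auto
  have cu: "vec n (cd u) = c"
    using cn by (auto simp: u_def coord_lc)
  have e: "Tr V e n (mu V e n x (mu V e n x (e i) u)) = Tr V e n (mu V e n x (e i))" if "i < n" for i
    using gram_mult_vec[OF that u, of x] that unfolding cu Gc t_def by simp
  have "Tr V e n (mu V e n x (mu V e n x v u)) = Tr V e n (mu V e n x v)" if v: "v \<in> carrier V" for v
  proof -
    have "mu V e n x v u = lc V (\<lambda>j. mu V e n x (e j) u) n (cd v)"
      using lin_map_lc[OF vspace_axioms vspace_axioms mu_lin_left, of n e x "cd v" u] v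
      by (simp add: lc_coord)
    then have "Tr V e n (mu V e n x (mu V e n x v u)) = (\<Sum>j<n. cd v j * Tr V e n (mu V e n x (e j)))"
      by (simp add: Tr_mu_lc e)
    also have "\<dots> = Tr V e n (mu V e n x v)"
      using Tr_mu_lc[of n e x "cd v"] v by (simp add: lc_coord)
    finally show ?thesis .
  qed
  then show ?thesis using u by blast
qed

section \<open>The trace of a map computed on its image\<close>

lemma lin_map_image: "f \<in> lin_map U W \<Longrightarrow> f ` carrier U \<subseteq> carrier W"
  unfolding LinearCombinations.module_hom_def by auto

text \<open>\<open>f\<close> factors through its image as the coordinate map \<open>p\<close>
  followed by the combination of the \<open>w i\<close>, and the trace of a composite of two maps
  does not depend on their order. So the trace can be read on the image, where a square-zero map is
  zero and an idempotent map is the identity.\<close>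

lemma Tr_via_image:
  assumes f: "f \<in> lin_map V V"
  shows "\<exists>r w p. (\<forall>i<r. w i \<in> f ` carrier V) \<and> indep V w r \<and>
    (\<forall>v\<in>carrier V. f v = lc V w r (p v)) \<and> Tr V e n f = (\<Sum>i<r. p (w i) i)"
proof -
  have cl: "f v \<in> carrier V" if "v \<in> carrier V" for v
    using LinearCombinations.module_hom_closed[OF f] that by auto
  then have sub: "f ` carrier V \<subseteq> carrier V" by auto
  obtain r w where rw: "(\<forall>i<r. w i \<in> f ` carrier V) \<and> indep V w r \<and>
      (\<forall>v\<in>f ` carrier V. \<exists>c. v = lc V w r c)"
    using maximal_indep[OF fin_dim sub] by (elim exE)
  have w: "indep V w r" using rw by blast
  have w1: "w i \<in> f ` carrier V" if "i < r" for i
    using rw that by blast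
  have w3: "\<exists>c. v = lc V w r c" if "v \<in> f ` carrier V" for v
    by (rule bspec[OF conjunct2[OF conjunct2[OF rw]] that])
  have wc: "w i \<in> carrier V" if "i < r" for i using subsetD[OF sub w1[OF that]] .
  define p where "p v = (SOME c. f v = lc V w r c)" for v
  have p: "f v = lc V w r (p v)" if "v \<in> carrier V" for v
    unfolding p_def by (rule someI_ex[OF w3]) (use that in blast)
  \<comment> \<open>\<open>p\<close> comes from a choice, but coordinates along the independent
    family \<open>w\<close> are unique, which makes \<open>p\<close> linear.\<close>
  have pw: "p v i = (\<Sum>j<n. cd v j * p (e j) i)" if "v \<in> carrier V" "i < r" for v i
  proof -
    have "f v = lc V (\<lambda>j. f (e j)) n (cd v)"
      using lin_map_lc[OF vspace_axioms vspace_axioms f, of n e "cd v"] that by (simp add: lc_coord)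
    also have "\<dots> = lc V w r (\<lambda>i. \<Sum>j<n. cd v j * p (e j) i)"
      by (rule lc_lc[OF wc p]) auto
    finally have "lc V w r (p v) = lc V w r (\<lambda>i. \<Sum>j<n. cd v j * p (e j) i)"
      using p[OF that(1)] by simp
    then show ?thesis using indep_lc_eqD[OF w _ _ that(2), of "p v" "\<lambda>i. \<Sum>j<n. cd v j * p (e j) i"] wc
      by simp
  qed
  have "Tr V e n f = (\<Sum>j<n. \<Sum>i<r. p (e j) i * cd (w i) j)"
    unfolding Tr_def by (intro sum.cong refl) (use p wc in \<open>simp add: coord_lc'\<close>)
  also have "\<dots> = (\<Sum>i<r. \<Sum>j<n. cd (w i) j * p (e j) i)"
    by (subst sum.swap) (simp add: mult.commute)
  also have "\<dots> = (\<Sum>i<r. p (w i) i)"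
    using pw[OF wc, symmetric] by (intro sum.cong refl) auto
  finally show ?thesis using w w1 p by (intro exI[of _ r] exI[of _ w] exI[of _ p]) simp
qed

lemma Tr_square_zero:
  assumes f: "f \<in> lin_map V V" and ff: "\<And>v. v \<in> carrier V \<Longrightarrow> f (f v) = \<zero>"
  shows "Tr V e n f = 0"
proof -
  obtain r w p where rw: "(\<forall>i<r. w i \<in> f ` carrier V) \<and> indep V w r \<and>
    (\<forall>v\<in>carrier V. f v = lc V w r (p v)) \<and> Tr V e n f = (\<Sum>i<r. p (w i) i)"
    using Tr_via_image[OF f] by (elim exE)
  have w: "w i \<in> f ` carrier V" "indep V w r" if "i < r" for i using rw that by auto
  have p: "f v = lc V w r (p v)" if "v \<in> carrier V" for v
    by (rule bspec[OF conjunct1[OF conjunct2[OF conjunct2[OF rw]]] that])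
  have t: "Tr V e n f = (\<Sum>i<r. p (w i) i)" using rw by blast
  have "p (w i) i = 0" if "i < r" for i
  proof -
    have "w i \<in> carrier V" using subsetD[OF lin_map_image[OF f] w(1)[OF that]] .
    moreover have "f (w i) = \<zero>" using w(1)[OF that] by (rule imageE) (simp add: ff)
    ultimately have "lc V w r (p (w i)) = \<zero>" using p[of "w i"] by simp
    then show ?thesis using w(2)[OF that] that unfolding indep_def by blast
  qed
  then show ?thesis using t by simp
qed

end

lemma (in based) Tr_idempotent:
  fixes f :: "'v \<Rightarrow> 'v"
  assumes ch: "CHAR('k) = 0" and f: "f \<in> lin_map V V" and ff: "\<And>v. v \<in> carrier V \<Longrightarrow> f (f v) = f v"
    and t0: "Tr V e n f = 0" and v: "v \<in> carrier V"
  shows "f v = \<zero>"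
proof -
  obtain r w p where rw: "(\<forall>i<r. w i \<in> f ` carrier V) \<and> indep V w r \<and>
    (\<forall>v\<in>carrier V. f v = lc V w r (p v)) \<and> Tr V e n f = (\<Sum>i<r. p (w i) i)"
    using Tr_via_image[OF f] by (elim exE)
  have w: "w i \<in> f ` carrier V" "indep V w r" if "i < r" for i using rw that by auto
  have p: "f v = lc V w r (p v)" if "v \<in> carrier V" for v
    by (rule bspec[OF conjunct1[OF conjunct2[OF conjunct2[OF rw]]] that])
  have t: "Tr V e n f = (\<Sum>i<r. p (w i) i)" using rw by blast
  have wc: "w i \<in> carrier V" if "i < r" for i
    using subsetD[OF lin_map_image[OF f] w(1)[OF that]] .
  have "p (w i) i = 1" if "i < r" for i
  proof -
    have "f (w i) = w i" using w(1)[OF that] by (rule imageE) (simp add: ff)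
    also have "w i = lc V w r (\<lambda>j. if j = i then 1 else 0)"
      using wc that by (simp add: lc_delta)
    finally have "lc V w r (p (w i)) = lc V w r (\<lambda>j. if j = i then 1 else 0)"
      using p[OF wc[OF that]] by simp
    then show ?thesis using indep_lc_eqD[OF w(2)[OF that] _ _ that, of "p (w i)" "\<lambda>j. if j = i then 1 else 0"] wc
      by simp
  qed
  \<comment> \<open>The trace counts the \<open>r\<close> basis vectors of the image; once
    \<open>r = 0\<close>, the empty combination gives \<open>f v = \<zero>\<close>.\<close>
  then have "of_nat r = (0::'k)" using t t0 by simp
  then have "r = 0" using ch by (simp add: of_nat_eq_0_iff_char_dvd)
  then show ?thesis using p[OF v] by simp
qed

section \<open>Finite-dimensional reduced algebras\<close>

text \<open>The notion \<open>algebra class_ring A\<close> recast over \<open>vspace\<close>, so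
  that indexed combinations and the scalar laws apply to algebras.\<close>

locale kalg = vspace A + A?: cring A for A :: "('k::field, 'a) module" (structure) +
  assumes smult_mult_left: "x \<in> carrier A \<Longrightarrow> y \<in> carrier A \<Longrightarrow> (c \<odot> x) \<otimes> y = c \<odot> (x \<otimes> y)"

lemma kalg_iff: "kalg A \<longleftrightarrow> algebra class_ring A"
proof
  assume "kalg A"
  then interpret kalg A .
  show "algebra class_ring A"
    by (rule algebraI)
      (auto simp: smult_add_left smult_add_right smult_mult smult_mult_left
        intro: A.is_cring class_cring.is_cring)
next
  assume "algebra class_ring A"
  then interpret algebra class_ring A .
  show "kalg A"
    unfolding kalg_def vspace_def vectorspace_def kalg_axioms_def
    using class_field smult_assoc2 by (auto intro: M_cring module)
qed

text \<open>Squares detect all nilpotents: the last nonzero power of a nonzero nilpotent element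
  squares to zero.\<close>

definition reduced_alg :: "('k, 'a) module \<Rightarrow> bool" where
  "reduced_alg A \<longleftrightarrow> (\<forall>a\<in>carrier A. a \<otimes>\<^bsub>A\<^esub> a = \<zero>\<^bsub>A\<^esub> \<longrightarrow> a = \<zero>\<^bsub>A\<^esub>)"

lemma reduced_algD: "reduced_alg A \<Longrightarrow> a \<in> carrier A \<Longrightarrow> a \<otimes>\<^bsub>A\<^esub> a = \<zero>\<^bsub>A\<^esub> \<Longrightarrow> a = \<zero>\<^bsub>A\<^esub>"
  unfolding reduced_alg_def by blast

context vspace
begin

lemma smult_eq_zero:
  assumes "c \<odot> x = \<zero>" "x \<in> carrier V" "x \<noteq> \<zero>"
  shows "c = 0"
proof (rule ccontr)
  assume "c \<noteq> 0"
  then have "x = inverse c \<odot> (c \<odot> x)"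
    using smult_mult[OF assms(2), of "inverse c" c] assms(2) by simp
  then show False using assms by simp
qed

lemma lc_extend:
  assumes "m \<le> n" "\<And>i. i < n \<Longrightarrow> b i \<in> carrier V" "\<And>i. m \<le> i \<Longrightarrow> i < n \<Longrightarrow> c i = 0"
  shows "lc V b n c = lc V b m c"
  using assms
proof (induction n)
  case (Suc n)
  show ?case
  proof (cases "m = Suc n")
    case False
    then show ?thesis using Suc by (simp add: lc_Suc)
  qed simp
qed simp

lemma lc_Suc_shift:
  "(\<And>i. i \<le> n \<Longrightarrow> b i \<in> carrier V) \<Longrightarrow>
    lc V b (Suc n) c = c 0 \<odot> b 0 \<oplus> lc V (\<lambda>i. b (Suc i)) n (\<lambda>i. c (Suc i))"
proof (induction n)
  case 0
  then show ?case using lc_Suc[of 0 b c] by simp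
next
  case (Suc n)
  have "lc V b (Suc (Suc n)) c = lc V b (Suc n) c \<oplus> c (Suc n) \<odot> b (Suc n)"
    using Suc.prems by (subst lc_Suc) auto
  then show ?case using Suc by (simp add: lc_Suc[of _ "\<lambda>i. b (Suc i)"] a_assoc)
qed

lemma lc_single:
  assumes "i < n" "w \<in> carrier V"
  shows "lc V (\<lambda>j. if j = i then w else \<zero>) n c = c i \<odot> w"
proof -
  have "lc V (\<lambda>j. if j = i then w else \<zero>) m c = (if i < m then c i \<odot> w else \<zero>)" for m
    using assms(2) by (induction m) (auto simp: lc_Suc less_Suc_eq)
  then show ?thesis using assms(1) by simp
qed

end

section \<open>Polynomials in one element of an algebra\<close>

context kalg
begin

lemma smult_mult_right: "x \<in> carrier A \<Longrightarrow> y \<in> carrier A \<Longrightarrow> x \<otimes> (c \<odot> y) = c \<odot> (x \<otimes> y)"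
  using smult_mult_left[of y x c] by (simp add: A.m_comm)

lemma mult_lc:
  "y \<in> carrier A \<Longrightarrow> (\<And>i. i < n \<Longrightarrow> b i \<in> carrier A) \<Longrightarrow> y \<otimes> lc A b n c = lc A (\<lambda>i. y \<otimes> b i) n c"
  by (induction n) (simp_all add: lc_Suc A.r_distr smult_mult_right)

text \<open>Any upper bound may replace the degree, so that several polynomials can be evaluated
  over a common range of exponents.\<close>

lemma poly_at_bound:
  assumes "Polynomial.degree p \<le> N" "a \<in> carrier A"
  shows "poly_at A p a = lc A (\<lambda>i. a [^] i) (Suc N) (Polynomial.coeff p)"
proof -
  have "poly_at A p a = lc A (\<lambda>i. a [^] i) (Suc (Polynomial.degree p)) (Polynomial.coeff p)"
    unfolding poly_at_def lc_def lessThan_Suc_atMost ..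
  then show ?thesis
    using assms by (subst lc_extend[of "Suc (Polynomial.degree p)"]) (auto intro: coeff_eq_0)
qed

lemma poly_at_closed [simp, intro]: "a \<in> carrier A \<Longrightarrow> poly_at A p a \<in> carrier A"
  by (subst poly_at_bound[OF order_refl]) auto

text \<open>Horner's scheme; it opens \<open>poly_at\<close> to induction over
  \<open>pCons\<close>.\<close>

lemma poly_at_pCons:
  assumes "a \<in> carrier A"
  shows "poly_at A (pCons c p) a = c \<odot> \<one> \<oplus> a \<otimes> poly_at A p a"
proof -
  let ?N = "Polynomial.degree p"
  have "poly_at A (pCons c p) a = lc A (\<lambda>i. a [^] i) (Suc (Suc ?N)) (Polynomial.coeff (pCons c p))"
    using assms by (intro poly_at_bound) (auto simp: degree_pCons_le)
  also have "\<dots> = c \<odot> \<one> \<oplus> lc A (\<lambda>i. a \<otimes> a [^] i) (Suc ?N) (Polynomial.coeff p)"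
    using assms by (subst lc_Suc_shift) (auto simp: A.m_comm)
  also have "lc A (\<lambda>i. a \<otimes> a [^] i) (Suc ?N) (Polynomial.coeff p) = a \<otimes> poly_at A p a"
    using assms by (simp add: poly_at_bound[OF order_refl] mult_lc)
  finally show ?thesis .
qed

lemma poly_at_0 [simp]: "a \<in> carrier A \<Longrightarrow> poly_at A 0 a = \<zero>"
  by (subst poly_at_bound[of _ 0]) (auto intro: lc_zero)

lemma poly_at_add:
  assumes "a \<in> carrier A"
  shows "poly_at A (p + q) a = poly_at A p a \<oplus> poly_at A q a"
proof -
  let ?N = "max (Polynomial.degree p) (Polynomial.degree q)"
  show ?thesis
    using assms degree_add_le_max[of p q]
    by (simp add: poly_at_bound[of _ ?N] lc_add[symmetric] coeff_add[abs_def])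
qed

lemma poly_at_smult:
  assumes "a \<in> carrier A"
  shows "poly_at A (Polynomial.smult c p) a = c \<odot> poly_at A p a"
  using assms degree_smult_le[of c p]
  by (simp add: poly_at_bound[of _ "Polynomial.degree p"] lc_smult[symmetric] coeff_smult[abs_def])

lemma poly_at_mult:
  assumes "a \<in> carrier A"
  shows "poly_at A (p * q) a = poly_at A p a \<otimes> poly_at A q a"
proof (induction p)
  case 0
  then show ?case using assms by simp
next
  case (pCons c p)
  have "poly_at A (pCons c p * q) a = c \<odot> poly_at A q a \<oplus> a \<otimes> (poly_at A p a \<otimes> poly_at A q a)"
    using assms pCons by (simp add: poly_at_add poly_at_smult poly_at_pCons)
  also have "\<dots> = poly_at A (pCons c p) a \<otimes> poly_at A q a"
    using assms by (simp add: poly_at_pCons A.l_distr smult_mult_left A.m_assoc)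
  finally show ?case .
qed

lemma exists_annihilator:
  assumes "fin_dim" "a \<in> carrier A"
  shows "\<exists>p. p \<noteq> 0 \<and> poly_at A p a = \<zero>"
proof -
  let ?d = "vectorspace.dim class_ring A"
  \<comment> \<open>The exponents 0 to \<open>?d\<close> give one power more than the
    dimension.\<close>
  have "\<not> indep A (\<lambda>i. a [^] i) (Suc ?d)"
    using indep_le_dim[OF assms(1), of "\<lambda>i. a [^] i" "Suc ?d"] assms(2) by auto
  then obtain c i where c: "lc A (\<lambda>i. a [^] i) (Suc ?d) c = \<zero>" "i < Suc ?d" "c i \<noteq> 0"
    unfolding indep_def by auto
  define p where "p = (\<Sum>i\<le>?d. Polynomial.monom (c i) i)"
  have cp: "Polynomial.coeff p j = (if j \<le> ?d then c j else 0)" for j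
    unfolding p_def by (simp add: coeff_sum)
  have "Polynomial.degree p \<le> ?d" by (rule degree_le) (simp add: cp)
  then have "poly_at A p a = lc A (\<lambda>i. a [^] i) (Suc ?d) (Polynomial.coeff p)"
    using assms by (intro poly_at_bound)
  also have "\<dots> = lc A (\<lambda>i. a [^] i) (Suc ?d) c"
    using assms by (intro lc_cong) (auto simp: cp)
  finally have "poly_at A p a = \<zero>" using c by simp
  moreover have "p \<noteq> 0" using c(2,3) cp[of i] by auto
  ultimately show ?thesis by blast
qed

text \<open>Let \<open>?q\<close> be the value at \<open>a\<close> of the tail of the polynomial.
  From \<open>c \<odot> a \<oplus> a \<otimes> (a \<otimes> ?q) = \<zero>\<close> with
  \<open>c \<noteq> 0\<close> one solves for \<open>a\<close>. If \<open>c = 0\<close>, the element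
  \<open>a \<otimes> ?q\<close> has square zero, hence vanishes, and the tail satisfies the same
  kind of relation.\<close>

lemma von_neumann_regular:
  assumes "fin_dim" "reduced_alg A" "a \<in> carrier A"
  shows "\<exists>b\<in>carrier A. a \<otimes> (a \<otimes> b) = a"
proof -
  \<comment> \<open>The relation carries an extra factor \<open>a\<close>: the constant coefficient
    then contributes \<open>c \<odot> a\<close>, and a relation of exactly this form is left after a
    cancellation.\<close>
  have "\<exists>b\<in>carrier A. a \<otimes> (a \<otimes> b) = a" if "p \<noteq> 0" "a \<otimes> poly_at A p a = \<zero>" for p
    using that
  proof (induction p)
    case (pCons c p)
    let ?q = "poly_at A p a"
    have q: "?q \<in> carrier A" using assms(3) by auto
    have eq: "c \<odot> a \<oplus> a \<otimes> (a \<otimes> ?q) = \<zero>"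
      using pCons.prems(2) assms(3) q by (simp add: poly_at_pCons A.r_distr smult_mult_right)
    show ?case
    proof (cases "c = 0")
      case True
      then have "a \<otimes> (a \<otimes> ?q) = \<zero>" using eq assms(3) q by simp
      then have "?q \<otimes> (a \<otimes> (a \<otimes> ?q)) = \<zero>" using q by simp
      moreover have "(a \<otimes> ?q) \<otimes> (a \<otimes> ?q) = ?q \<otimes> (a \<otimes> (a \<otimes> ?q))"
        using A.m_comm[OF assms(3) q] A.m_assoc[OF q assms(3), of "a \<otimes> ?q"] assms(3) q by simp
      ultimately have "(a \<otimes> ?q) \<otimes> (a \<otimes> ?q) = \<zero>" by (simp only:)
      then have "a \<otimes> ?q = \<zero>"
        by (rule reduced_algD[OF assms(2), rotated]) (use assms(3) q in blast)
      then show ?thesis using pCons True by auto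
    next
      case False
      let ?b = "(- inverse c) \<odot> ?q"
      have "a \<otimes> (a \<otimes> ?q) = (- c) \<odot> a"
        using eq assms(3) q minus_equality[of "a \<otimes> (a \<otimes> ?q)" "c \<odot> a"]
        by (simp add: smult_neg a_comm)
      then have "a \<otimes> (a \<otimes> ?b) = (- inverse c) \<odot> ((- c) \<odot> a)"
        using assms(3) q by (simp add: smult_mult_right)
      also have "\<dots> = a" using False assms(3) by (simp add: smult_mult[symmetric])
      finally show ?thesis using q by blast
    qed
  qed simp
  moreover obtain p where "p \<noteq> 0" "poly_at A p a = \<zero>"
    using exists_annihilator[OF assms(1,3)] by blast
  ultimately show ?thesis using assms(3) by simp
qed

end

section \<open>Orthogonal idempotents and corner algebras\<close>

definition orth_idems :: "('k, 'a) module \<Rightarrow> (nat \<Rightarrow> 'a) \<Rightarrow> nat \<Rightarrow> bool" where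
  "orth_idems A E r \<longleftrightarrow> (\<forall>i<r. E i \<in> carrier A \<and> E i \<noteq> \<zero>\<^bsub>A\<^esub> \<and>
     (\<forall>j<r. E i \<otimes>\<^bsub>A\<^esub> E j = (if i = j then E i else \<zero>\<^bsub>A\<^esub>)))"

text \<open>For idempotent \<open>e\<close> the fixed-point condition describes the multiples of
  \<open>e\<close>, so this is the ideal generated by \<open>e\<close> as an algebra with identity
  \<open>e\<close>. Its element type is that of \<open>A\<close>, as \<open>finite_etale\<close>
  asks of the factors.\<close>

definition corner :: "('k, 'a) module \<Rightarrow> 'a \<Rightarrow> ('k, 'a) module" where
  "corner A e = A\<lparr>carrier := {a \<in> carrier A. e \<otimes>\<^bsub>A\<^esub> a = a}, monoid.one := e\<rparr>"

lemma corner_sel [simp]: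
  "carrier (corner A e) = {a \<in> carrier A. e \<otimes>\<^bsub>A\<^esub> a = a}"
  "monoid.mult (corner A e) = monoid.mult A" "monoid.one (corner A e) = e"
  "ring.zero (corner A e) = ring.zero A" "ring.add (corner A e) = ring.add A"
  "module.smult (corner A e) = module.smult A"
  unfolding corner_def by simp_all

context kalg
begin

lemma orth_idemsD:
  assumes "orth_idems A E r" "i < r"
  shows "E i \<in> carrier A" "E i \<noteq> \<zero>" "E i \<otimes> E i = E i"
    "j < r \<Longrightarrow> i \<noteq> j \<Longrightarrow> E i \<otimes> E j = \<zero>"
  using assms unfolding orth_idems_def by auto

text \<open>Multiplication by \<open>E i\<close> projects to the \<open>i\<close>-th component. The
  components \<open>x j\<close> may be any elements of the corners, which covers combinations of the
  \<open>E j\<close> as well as tuples in the product of the corners.\<close>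

lemma orth_mult_lc:
  assumes E: "orth_idems A E r" and i: "i < r"
    and x: "\<And>j. j < r \<Longrightarrow> x j \<in> carrier A" "\<And>j. j < r \<Longrightarrow> E j \<otimes> x j = x j"
  shows "E i \<otimes> lc A x r c = c i \<odot> x i"
proof -
  note D = orth_idemsD[OF E]
  have "E i \<otimes> x j = (if j = i then x i else \<zero>)" if j: "j < r" for j
  proof (cases "j = i")
    case True
    then show ?thesis using x i by simp
  next
    case False
    have "E i \<otimes> x j = (E i \<otimes> E j) \<otimes> x j"
      using A.m_assoc[OF D(1)[OF i] D(1)[OF j] x(1)[OF j]] x(2)[OF j] by simp
    then show ?thesis using D(4)[OF i j] False x(1)[OF j] by simp
  qed
  then have "lc A (\<lambda>j. E i \<otimes> x j) r c = lc A (\<lambda>j. if j = i then x i else \<zero>) r c"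
    using D(1) x(1) i by (intro lc_cong) auto
  then show ?thesis
    using mult_lc[OF D(1)[OF i] x(1)] lc_single[OF i x(1)[OF i]] by simp
qed

lemma orth_mult_lc_self:
  assumes E: "orth_idems A E r" and i: "i < r"
  shows "E i \<otimes> lc A E r c = c i \<odot> E i"
  by (rule orth_mult_lc[OF E i]) (use orth_idemsD[OF E] in auto)

lemma orth_indep:
  assumes E: "orth_idems A E r"
  shows "indep A E r"
  unfolding indep_def
proof (intro allI impI)
  fix c i assume "lc A E r c = \<zero>" "i < r"
  then have "c i \<odot> E i = \<zero>"
    using orth_mult_lc_self[OF E, of i c] orth_idemsD(1)[OF E, of i] by simp
  then show "c i = 0"
    using smult_eq_zero orth_idemsD(1,2)[OF E \<open>i < r\<close>] by blast
qed

text \<open>Orthogonal idempotents are independent, so the dimension bounds their number. Greatest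
  length is stronger than maximality for inclusion: it also excludes families in which a member has
  been split in two.\<close>

lemma exists_maximal_orth_idems:
  assumes "fin_dim"
  shows "\<exists>r E. orth_idems A E r \<and> (\<forall>F. \<not> orth_idems A F (Suc r))"
proof -
  define P where "P r \<longleftrightarrow> (\<exists>E. orth_idems A E r)" for r
  have P0: "P 0" unfolding P_def orth_idems_def by simp
  have bd: "r \<le> vectorspace.dim class_ring A" if Pr: "P r" for r
  proof -
    obtain E where E: "orth_idems A E r" using Pr unfolding P_def by (elim exE)
    show ?thesis
      using indep_le_dim[OF assms orth_indep[OF E]] orth_idemsD(1)[OF E] by simp
  qed
  define r where "r = Greatest P"
  have "P r" unfolding r_def by (rule GreatestI_nat[of P, OF P0 bd])
  moreover have "\<not> P (Suc r)"
    using Greatest_le_nat[of P "Suc r", OF _ bd] unfolding r_def by auto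
  ultimately show ?thesis unfolding P_def by (elim exE) (intro exI[of _ r] exI conjI, assumption, simp)
qed

text \<open>If the sum \<open>s\<close> differed from the identity, its complement
  \<open>\<one> \<ominus> s\<close> would be a nonzero idempotent orthogonal to all
  \<open>E i\<close> and could be appended.\<close>

lemma max_orth_sum:
  assumes E: "orth_idems A E r" and max: "\<And>F. \<not> orth_idems A F (Suc r)"
  shows "lc A E r (\<lambda>_. 1) = \<one>"
proof (rule ccontr)
  note D = orth_idemsD[OF E]
  define s where "s = lc A E r (\<lambda>_. 1)"
  define t where "t = \<one> \<ominus> s"
  assume "lc A E r (\<lambda>_. 1) \<noteq> \<one>"
  then have ne: "s \<noteq> \<one>" unfolding s_def .
  have s: "s \<in> carrier A" unfolding s_def using D(1) by auto
  have t: "t \<in> carrier A" unfolding t_def using s by auto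
  have Es: "E i \<otimes> s = E i" if "i < r" for i
    unfolding s_def using orth_mult_lc_self[OF E that] D(1)[OF that] by simp
  have "s \<otimes> s = lc A (\<lambda>i. s \<otimes> E i) r (\<lambda>_. 1)"
    using mult_lc[OF s D(1)] unfolding s_def by simp
  also have "\<dots> = s"
    unfolding s_def[symmetric] using D(1) Es s
    by (subst lc_cong[where b' = E and c' = "\<lambda>_. 1"]) (auto simp: A.m_comm s_def[symmetric])
  finally have ss: "s \<otimes> s = s" .
  have Et: "E i \<otimes> t = \<zero>" if "i < r" for i
    using Es[OF that] D(1)[OF that] s by (simp add: t_def minus_eq A.r_distr A.r_minus r_neg)
  have st: "s \<otimes> t = \<zero>"
    using ss s by (simp add: t_def minus_eq A.r_distr A.r_minus r_neg)
  have "t \<otimes> t = t \<ominus> s \<otimes> t"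
    using s t by (simp add: t_def minus_eq A.l_distr A.l_minus)
  then have tt: "t \<otimes> t = t" using st t by (simp add: minus_eq)
  have tn: "t \<noteq> \<zero>" using ne s unfolding t_def by simp
  have "orth_idems A (\<lambda>i. if i < r then E i else t) (Suc r)"
    unfolding orth_idems_def using D Et tt tn t A.m_comm[OF D(1) t]
    by (auto simp: less_Suc_eq)
  then show False using max by blast
qed

text \<open>A different nonzero idempotent \<open>f\<close> below \<open>E i\<close> splits
  \<open>E i\<close> into the orthogonal idempotents \<open>f\<close> and
  \<open>E i \<ominus> f\<close>; putting both in place of \<open>E i\<close> lengthens the
  family.\<close>

lemma max_orth_primitive:
  assumes E: "orth_idems A E r" and max: "\<And>F. \<not> orth_idems A F (Suc r)"
    and i: "i < r" and f: "f \<in> carrier A" "f \<otimes> f = f" "f \<noteq> \<zero>" "E i \<otimes> f = f"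
  shows "f = E i"
proof (rule ccontr)
  assume ne: "f \<noteq> E i"
  note D = orth_idemsD[OF E]
  define g where "g = E i \<ominus> f"
  have Ei: "E i \<in> carrier A" using D(1) i .
  have g: "g \<in> carrier A" unfolding g_def using Ei f(1) by auto
  have gn: "g \<noteq> \<zero>" using ne Ei f(1) unfolding g_def by simp
  have fE: "f \<otimes> E i = f" using f(4) A.m_comm[OF f(1) Ei] by simp
  have fg: "f \<otimes> g = \<zero>"
    using f Ei fE by (simp add: g_def minus_eq A.r_distr A.r_minus r_neg)
  have Eg: "E i \<otimes> g = g"
    using f Ei D(3)[OF i] by (simp add: g_def minus_eq A.r_distr A.r_minus)
  have "g \<otimes> g = E i \<otimes> g \<ominus> f \<otimes> g"
    using g f(1) Ei by (simp add: g_def minus_eq A.l_distr A.l_minus)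
  then have gg: "g \<otimes> g = g" using Eg fg g by (simp add: minus_eq)
  have orthE: "x \<otimes> E j = \<zero>" if "x \<in> carrier A" "E i \<otimes> x = x" "j < r" "j \<noteq> i" for x j
  proof -
    have "x \<otimes> E j = (x \<otimes> E i) \<otimes> E j" using that A.m_comm[OF that(1) Ei] by simp
    also have "\<dots> = x \<otimes> (E i \<otimes> E j)" using A.m_assoc that(1) Ei D(1)[OF that(3)] by simp
    finally show ?thesis using D(4)[OF i that(3)] that by simp
  qed
  \<comment> \<open>\<open>f\<close> takes over position \<open>i\<close>, and the other half
    \<open>g\<close> goes to the new position \<open>r\<close>.\<close>
  let ?F = "\<lambda>j. if j = i then f else if j < r then E j else g"
  have fEj: "f \<otimes> E j = \<zero>" "E j \<otimes> f = \<zero>" and gEj: "g \<otimes> E j = \<zero>" "E j \<otimes> g = \<zero>"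
    if "j < r" "j \<noteq> i" for j
    using orthE[OF f(1) f(4) that] orthE[OF g Eg that] A.m_comm[OF D(1)[OF that(1)]] f(1) g by auto
  have gf: "g \<otimes> f = \<zero>" using fg A.m_comm[OF f(1) g] by simp
  have "orth_idems A ?F (Suc r)"
    unfolding orth_idems_def using D f g gn gg fg gf fEj gEj i
    by (auto simp: less_Suc_eq)
  then show False using max by blast
qed

text \<open>With \<open>a \<otimes> (a \<otimes> b) = a\<close>, the product
  \<open>a \<otimes> b\<close> is idempotent, and it is nonzero because multiplying it by
  \<open>a\<close> gives back \<open>a\<close>.\<close>

lemma idempotent_multiple:
  assumes "fin_dim" "reduced_alg A" "a \<in> carrier A" "a \<noteq> \<zero>"
  shows "\<exists>b\<in>carrier A. (a \<otimes> b) \<otimes> (a \<otimes> b) = a \<otimes> b \<and> a \<otimes> b \<noteq> \<zero>"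
proof -
  obtain b where b: "b \<in> carrier A" "a \<otimes> (a \<otimes> b) = a"
    using von_neumann_regular[OF assms(1-3)] by blast
  have "(a \<otimes> b) \<otimes> (a \<otimes> b) = b \<otimes> (a \<otimes> (a \<otimes> b))"
    using A.m_comm[OF assms(3) b(1)] A.m_assoc[OF b(1) assms(3), of "a \<otimes> b"] assms(3) b(1) by simp
  then have "(a \<otimes> b) \<otimes> (a \<otimes> b) = a \<otimes> b"
    using b A.m_comm[OF assms(3) b(1)] by simp
  moreover have "a \<otimes> b \<noteq> \<zero>" using b assms(3,4) by auto
  ultimately show ?thesis using b(1) by blast
qed

lemma kalg_corner:
  assumes e: "e \<in> carrier A" "e \<otimes> e = e"
  shows "kalg (corner A e)"
proof -
  have cl: "e \<otimes> (x \<otimes> y) = x \<otimes> y" if "x \<in> carrier A" "y \<in> carrier A" "e \<otimes> x = x" for x y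
    using A.m_assoc[OF e(1) that(1,2)] that(3) by simp
  have ab: "abelian_group (corner A e)"
  proof (rule abelian_groupI)
    fix x assume x: "x \<in> carrier (corner A e)"
    then show "\<exists>y\<in>carrier (corner A e). y \<oplus>\<^bsub>corner A e\<^esub> x = \<zero>\<^bsub>corner A e\<^esub>"
      using e by (intro bexI[of _ "\<ominus> x"]) (auto simp: A.r_minus l_neg)
  qed (use e in \<open>auto simp: A.r_distr a_ac\<close>)
  have cm: "comm_monoid (corner A e)"
    by (rule comm_monoidI) (use e cl in \<open>auto simp: A.m_assoc intro: A.m_comm\<close>)
  have cr: "cring (corner A e)"
    by (rule cringI[OF ab cm]) (auto simp: A.l_distr)
  have "algebra class_ring (corner A e)"
    by (rule algebraI[OF class_cring.is_cring cr])
      (use e in \<open>auto simp: smult_add_left smult_add_right smult_mult smult_mult_left smult_mult_right\<close>)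
  then show ?thesis unfolding kalg_iff .
qed

lemma lc_corner:
  assumes e: "e \<in> carrier A" "e \<otimes> e = e" and b: "\<And>i. i < n \<Longrightarrow> b i \<in> carrier (corner A e)"
  shows "lc (corner A e) b n c = lc A b n c"
proof -
  interpret C: kalg "corner A e" using kalg_corner[OF e] .
  show ?thesis using b
  proof (induction n)
    case (Suc n)
    have "lc (corner A e) b (Suc n) c = lc (corner A e) b n c \<oplus>\<^bsub>corner A e\<^esub> c n \<odot>\<^bsub>corner A e\<^esub> b n"
      using Suc.prems by (intro C.lc_Suc) auto
    moreover have "lc A b (Suc n) c = lc A b n c \<oplus> c n \<odot> b n"
      using Suc.prems by (intro lc_Suc) auto
    ultimately show ?case using Suc by simp
  qed simp
qed

lemma fin_dim_corner:
  assumes fd: "fin_dim" and e: "e \<in> carrier A" "e \<otimes> e = e"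
  shows "vectorspace.fin_dim class_ring (corner A e)"
proof -
  interpret C: kalg "corner A e" using kalg_corner[OF e] .
  obtain b where b: "ordered_basis A b (vectorspace.dim class_ring A)"
    using exists_ordered_basis[OF fd] by blast
  define n where "n = vectorspace.dim class_ring A"
  interpret B: based A b n using b ordered_basis_based unfolding n_def by blast
  \<comment> \<open>The projections of a basis of \<open>A\<close> span the corner.\<close>
  have eb: "e \<otimes> b i \<in> carrier (corner A e)" if "i < n" for i
    using e B.e_in[OF that] A.m_assoc[of e e "b i"] by simp
  show ?thesis
  proof (rule C.fin_dimI[OF eb])
    fix v assume v: "v \<in> carrier (corner A e)"
    have "v = e \<otimes> lc A b n (coord A b n v)" using v B.lc_coord[of v] by simp
    also have "\<dots> = lc (corner A e) (\<lambda>i. e \<otimes> b i) n (coord A b n v)"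
      using e eb by (subst lc_corner[OF e]) (auto simp: mult_lc)
    finally show "\<exists>c. v = lc (corner A e) (\<lambda>i. e \<otimes> b i) n c" by (rule exI[of _ "coord A b n v"])
  qed
qed

lemma field_corner:
  assumes fd: "fin_dim" and red: "reduced_alg A"
    and E: "orth_idems A E r" and max: "\<And>F. \<not> orth_idems A F (Suc r)" and i: "i < r"
  shows "field (corner A (E i))"
proof -
  note D = orth_idemsD[OF E i]
  interpret C: kalg "corner A (E i)" using kalg_corner D by blast
  show ?thesis
  proof (rule C.A.cring_fieldI2)
    show "\<zero>\<^bsub>corner A (E i)\<^esub> \<noteq> \<one>\<^bsub>corner A (E i)\<^esub>" using D(2) by simp
  next
    fix a assume a: "a \<in> carrier (corner A (E i))" "a \<noteq> \<zero>\<^bsub>corner A (E i)\<^esub>"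
    then obtain b where b: "b \<in> carrier A" "(a \<otimes> b) \<otimes> (a \<otimes> b) = a \<otimes> b" "a \<otimes> b \<noteq> \<zero>"
      using idempotent_multiple[OF fd red, of a] by auto
    have "E i \<otimes> (a \<otimes> b) = a \<otimes> b"
      using A.m_assoc[OF D(1), of a b] a b(1) by simp
    then have ab: "a \<otimes> b = E i"
      using max_orth_primitive[OF E max i] a b by simp
    \<comment> \<open>\<open>b\<close> may lie outside the corner; its projection
      \<open>E i \<otimes> b\<close> is the inverse inside.\<close>
    have "a \<otimes> (E i \<otimes> b) = E i \<otimes> (a \<otimes> b)"
      using a b(1) D(1) by (simp add: A.m_lcomm)
    then have "a \<otimes> (E i \<otimes> b) = E i" using ab D(3) by simp
    moreover have "E i \<otimes> b \<in> carrier (corner A (E i))"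
      using b(1) D A.m_assoc[OF D(1) D(1) b(1)] by simp
    ultimately show "\<exists>b\<in>carrier (corner A (E i)). a \<otimes>\<^bsub>corner A (E i)\<^esub> b = \<one>\<^bsub>corner A (E i)\<^esub>"
      by (intro bexI[of _ "E i \<otimes> b"]) simp_all
  qed
qed

text \<open>The map to the tuples \<open>E i \<otimes> a\<close> is inverted by summing the
  components: in one direction because the \<open>E i\<close> add up to the identity, in the other
  by orthogonality.\<close>

lemma product_of_corners:
  assumes E: "orth_idems A E r" and max: "\<And>F. \<not> orth_idems A F (Suc r)"
  shows "algebra_iso A (product_algebra r (\<lambda>i. corner A (E i)))"
proof -
  let ?P = "product_algebra r (\<lambda>i. corner A (E i))"
  note D = orth_idemsD[OF E]
  define h where "h a = (\<lambda>i\<in>{..<r}. E i \<otimes> a)" for a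
  have EE: "E i \<otimes> (E i \<otimes> a) = E i \<otimes> a" if "i < r" "a \<in> carrier A" for i a
    using A.m_assoc[OF D(1)[OF that(1)] D(1)[OF that(1)] that(2)] D(3)[OF that(1)] by simp
  have rec: "a = lc A (\<lambda>i. E i \<otimes> a) r (\<lambda>_. 1)" if "a \<in> carrier A" for a
  proof -
    have "a = a \<otimes> lc A E r (\<lambda>_. 1)" using max_orth_sum[OF E max] that by simp
    also have "\<dots> = lc A (\<lambda>i. a \<otimes> E i) r (\<lambda>_. 1)" by (rule mult_lc[OF that D(1)])
    also have "\<dots> = lc A (\<lambda>i. E i \<otimes> a) r (\<lambda>_. 1)"
      using D(1) that by (intro lc_cong) (auto simp: A.m_comm)
    finally show ?thesis .
  qed
  have hc: "h a \<in> carrier ?P" if "a \<in> carrier A" for a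
    using that D(1) EE unfolding h_def product_algebra_def by auto
  have inj: "inj_on h (carrier A)"
  proof (rule inj_onI)
    fix a b assume ab: "a \<in> carrier A" "b \<in> carrier A" "h a = h b"
    have "E i \<otimes> a = E i \<otimes> b" if "i < r" for i
      using fun_cong[OF ab(3), of i] that unfolding h_def by simp
    then have "lc A (\<lambda>i. E i \<otimes> a) r (\<lambda>_. 1) = lc A (\<lambda>i. E i \<otimes> b) r (\<lambda>_. 1)"
      using D(1) ab by (intro lc_cong) auto
    then show "a = b" using rec ab by simp
  qed
  have surj: "\<exists>a\<in>carrier A. h a = f" if f: "f \<in> carrier ?P" for f
  proof -
    have fi: "f i \<in> carrier A" "E i \<otimes> f i = f i" if "i < r" for i
      using f that unfolding product_algebra_def by (auto simp: PiE_iff)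
    let ?a = "lc A f r (\<lambda>_. 1)"
    have "?a \<in> carrier A" using fi by auto
    moreover have "h ?a = f"
    proof
      fix i
      show "h ?a i = f i"
        using orth_mult_lc[OF E _ fi, of i "\<lambda>_. 1"] fi f
        unfolding h_def product_algebra_def by (cases "i < r") (auto simp: PiE_iff extensional_def)
    qed
    ultimately show ?thesis by blast
  qed
  have bij: "bij_betw h (carrier A) (carrier ?P)"
    unfolding bij_betw_def using inj hc surj by blast
  have mult: "h (a \<otimes> b) = h a \<otimes>\<^bsub>?P\<^esub> h b" if "a \<in> carrier A" "b \<in> carrier A" for a b
  proof -
    have "E i \<otimes> (a \<otimes> b) = (E i \<otimes> a) \<otimes> (E i \<otimes> b)" if i: "i < r" for i
    proof -
      have "(E i \<otimes> a) \<otimes> (E i \<otimes> b) = E i \<otimes> (E i \<otimes> (a \<otimes> b))"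
        using D(1)[OF i] \<open>a \<in> carrier A\<close> \<open>b \<in> carrier A\<close> by (simp add: A.m_ac)
      then show ?thesis using EE[OF i] \<open>a \<in> carrier A\<close> \<open>b \<in> carrier A\<close> by simp
    qed
    then show ?thesis unfolding h_def product_algebra_def by auto
  qed
  have add: "h (a \<oplus> b) = h a \<oplus>\<^bsub>?P\<^esub> h b" if "a \<in> carrier A" "b \<in> carrier A" for a b
    using that D(1) unfolding h_def product_algebra_def by (auto simp: A.r_distr)
  have one: "h \<one> = \<one>\<^bsub>?P\<^esub>" unfolding h_def product_algebra_def using D(1) by auto
  have smult: "h (c \<odot> a) = c \<odot>\<^bsub>?P\<^esub> h a" if "a \<in> carrier A" for c a
    using that D(1) unfolding h_def product_algebra_def by (auto simp: smult_mult_right)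
  have "h \<in> ring_iso A ?P"
    unfolding ring_iso_def using hc mult add one bij by (auto intro!: ring_hom_memI)
  moreover have "h \<in> lin_map A ?P"
    unfolding LinearCombinations.module_hom_def using hc add smult by auto
  ultimately show ?thesis unfolding algebra_iso_def by blast
qed

text \<open>Take an annihilator of least degree. If it factors, one factor annihilates
  \<open>a\<close> because there are no zero divisors; this factor then has full degree and the
  other is constant.\<close>

lemma irreducible_annihilator:
  assumes fd: "fin_dim" and dom: "\<And>x y. x \<in> carrier A \<Longrightarrow> y \<in> carrier A \<Longrightarrow> x \<otimes> y = \<zero> \<Longrightarrow> x = \<zero> \<or> y = \<zero>"
    and nz: "\<one> \<noteq> \<zero>" and a: "a \<in> carrier A"
  shows "\<exists>p. Factorial_Ring.irreducible p \<and> poly_at A p a = \<zero>"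
proof -
  obtain p where p: "p \<noteq> 0" "poly_at A p a = \<zero>"
    and min: "\<And>q. q \<noteq> 0 \<Longrightarrow> poly_at A q a = \<zero> \<Longrightarrow> Polynomial.degree p \<le> Polynomial.degree q"
    using ex_has_least_nat[of "\<lambda>p. p \<noteq> 0 \<and> poly_at A p a = \<zero>" _ Polynomial.degree]
      exists_annihilator[OF fd a] by metis
  have "Factorial_Ring.irreducible p"
  proof (rule Factorial_Ring.irreducibleI)
    show "\<not> is_unit p"
    proof
      assume "is_unit p"
      then have "Polynomial.degree p = 0" using p(1) by (simp add: is_unit_iff_degree)
      then obtain c where c: "p = [:c:]" "c \<noteq> 0" using p(1) by (auto elim: degree_eq_zeroE)
      then have "c \<odot> \<one> = \<zero>" using p(2) a by (simp add: poly_at_pCons)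
      then show False using smult_eq_zero[of c \<one>] nz c by simp
    qed
    fix q s assume qs: "p = q * s"
    then have nz: "q \<noteq> 0" "s \<noteq> 0" using p(1) by auto
    have deg: "Polynomial.degree p = Polynomial.degree q + Polynomial.degree s"
      using qs nz by (simp add: degree_mult_eq)
    have "poly_at A q a = \<zero> \<or> poly_at A s a = \<zero>"
      using dom[of "poly_at A q a" "poly_at A s a"] p(2) qs a by (simp add: poly_at_mult)
    then have "Polynomial.degree s = 0 \<or> Polynomial.degree q = 0"
      using min[of q] min[of s] nz deg by auto
    then show "is_unit q \<or> is_unit s"
      using nz by (auto simp: is_unit_iff_degree)
  qed (rule p(1))
  then show ?thesis using p(2) by blast
qed

end

section \<open>Separability of the factors and splitting over closed fields\<close>

lemma irreducible_coprime_pderiv: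
  fixes p :: "'k::field_char_0 poly"
  assumes "Factorial_Ring.irreducible p"
  shows "coprime p (pderiv p)"
proof (rule coprimeI)
  fix c assume c: "c dvd p" "c dvd pderiv p"
  have p0: "p \<noteq> 0" "\<not> is_unit p" using assms by (auto simp: Factorial_Ring.irreducible_def)
  then have dp: "Polynomial.degree p > 0" by (auto simp: is_unit_iff_degree)
  obtain d where d: "p = c * d" using c(1) by (elim dvdE)
  \<comment> \<open>Characteristic 0 enters here: a polynomial of positive degree has a nonzero
    derivative, so a common divisor has smaller degree than \<open>p\<close>.\<close>
  have "pderiv p \<noteq> 0" using dp by (simp add: pderiv_eq_0_iff)
  then have "Polynomial.degree c \<le> Polynomial.degree (pderiv p)" using c(2) by (intro dvd_imp_degree_le)
  then have "Polynomial.degree c < Polynomial.degree p"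
    using dp by (simp add: degree_pderiv)
  then have "\<not> is_unit d" using d p0 by (auto simp: is_unit_iff_degree degree_mult_eq)
  then show "is_unit c" using assms d Factorial_Ring.irreducibleD by blast
qed

lemma finite_etale_reduced:
  fixes A :: "('k::field_char_0, 'a) module"
  assumes "kalg A" "vectorspace.fin_dim class_ring A" "reduced_alg A"
  shows "finite_etale A"
proof -
  interpret kalg A by fact
  obtain r E where E: "orth_idems A E r" and max: "\<And>F. \<not> orth_idems A F (Suc r)"
    using exists_maximal_orth_idems[OF assms(2)] by blast
  have "finite_separable_extension (corner A (E i))" if i: "i < r" for i
  proof -
    note D = orth_idemsD[OF E i]
    interpret C: kalg "corner A (E i)" using kalg_corner D by blast
    interpret F: field "corner A (E i)" using field_corner[OF assms(2,3) E max i] .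
    have dom: "x = \<zero>\<^bsub>corner A (E i)\<^esub> \<or> y = \<zero>\<^bsub>corner A (E i)\<^esub>"
      if "x \<in> carrier (corner A (E i))" "y \<in> carrier (corner A (E i))"
        "x \<otimes>\<^bsub>corner A (E i)\<^esub> y = \<zero>\<^bsub>corner A (E i)\<^esub>" for x y
      using F.integral[OF that(3,1,2)] .
    have fd: "C.fin_dim" using fin_dim_corner[OF assms(2)] D by blast
    have "separable_element (corner A (E i)) a" if aC: "a \<in> carrier (corner A (E i))" for a
    proof -
      obtain p where "Factorial_Ring.irreducible p" "poly_at (corner A (E i)) p a = \<zero>\<^bsub>corner A (E i)\<^esub>"
        using C.irreducible_annihilator[OF fd dom F.one_not_zero aC] by blast
      then show ?thesis
        unfolding separable_element_def using irreducible_coprime_pderiv by blast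
    qed
    then show ?thesis
      unfolding finite_separable_extension_def
      using C.kalg_axioms F.field_axioms fd unfolding kalg_iff by blast
  qed
  then show ?thesis
    unfolding finite_etale_def
    using assms(1)[unfolded kalg_iff] product_of_corners[OF E max]
    by (intro conjI exI[of _ r] exI[of _ "\<lambda>i. corner A (E i)"]) auto
qed

text \<open>An irreducible annihilator of a corner element is linear when every nonconstant
  polynomial has a root, so each corner consists of the scalar multiples of its
  \<open>E i\<close>.\<close>

lemma alg_closed_idempotent_basis:
  fixes A :: "('k::field, 'a) module" (structure)
  assumes closed: "\<And>p :: 'k poly. Polynomial.degree p > 0 \<Longrightarrow> \<exists>z. poly p z = 0"
    and A: "kalg A" "vectorspace.fin_dim class_ring A" "reduced_alg A"
  shows "\<exists>E r. orth_idems A E r \<and> ordered_basis A E r"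
proof -
  interpret kalg A by fact
  obtain r E where E: "orth_idems A E r" and max: "\<And>F. \<not> orth_idems A F (Suc r)"
    using exists_maximal_orth_idems[OF A(2)] by blast
  have mult: "\<exists>c. E i \<otimes> a = c \<odot> E i" if i: "i < r" and a: "a \<in> carrier A" for i a
  proof -
    note D = orth_idemsD[OF E i]
    interpret C: kalg "corner A (E i)" using kalg_corner D by blast
    interpret F: field "corner A (E i)" using field_corner[OF A(2,3) E max i] .
    have dom: "x = \<zero>\<^bsub>corner A (E i)\<^esub> \<or> y = \<zero>\<^bsub>corner A (E i)\<^esub>"
      if "x \<in> carrier (corner A (E i))" "y \<in> carrier (corner A (E i))"
        "x \<otimes>\<^bsub>corner A (E i)\<^esub> y = \<zero>\<^bsub>corner A (E i)\<^esub>" for x y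
      using F.integral[OF that(3,1,2)] .
    have fd: "C.fin_dim" using fin_dim_corner[OF A(2)] D by blast
    let ?b = "E i \<otimes> a"
    have b: "?b \<in> carrier (corner A (E i))"
      using a D A.m_assoc[OF D(1) D(1) a] by simp
    obtain p where p: "Factorial_Ring.irreducible p" "poly_at (corner A (E i)) p ?b = \<zero>\<^bsub>corner A (E i)\<^esub>"
      using C.irreducible_annihilator[OF fd dom F.one_not_zero b] by blast
    then have "Polynomial.degree p > 0" by (auto simp: Factorial_Ring.irreducible_def is_unit_iff_degree)
    then obtain z where "poly p z = 0" using closed by blast
    \<comment> \<open>The root splits off a linear factor; by irreducibility the cofactor is a
      nonzero constant \<open>c\<close>.\<close>
    then obtain q where q: "p = [:- z, 1:] * q" by (auto simp: poly_eq_0_iff_dvd elim: dvdE)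
    moreover have "\<not> is_unit [:- z, 1:]" by (simp add: is_unit_iff_degree)
    ultimately have "is_unit q" using p(1) Factorial_Ring.irreducibleD by blast
    then have "q \<noteq> 0" by auto
    with \<open>is_unit q\<close> have "Polynomial.degree q = 0" by (simp add: is_unit_iff_degree)
    with \<open>q \<noteq> 0\<close> obtain c where c: "q = [:c:]" "c \<noteq> 0" by (auto elim: degree_eq_zeroE)
    have "c \<odot>\<^bsub>corner A (E i)\<^esub> poly_at (corner A (E i)) [:- z, 1:] ?b = \<zero>\<^bsub>corner A (E i)\<^esub>"
      using p(2) C.poly_at_smult[OF b, of c "[:- z, 1:]"] unfolding q c by (simp add: mult.commute)
    then have "poly_at (corner A (E i)) [:- z, 1:] ?b = \<zero>\<^bsub>corner A (E i)\<^esub>"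
      using C.smult_eq_zero[of c] C.poly_at_closed[OF b] c(2) by blast
    then have "(- z) \<odot>\<^bsub>corner A (E i)\<^esub> \<one>\<^bsub>corner A (E i)\<^esub> \<oplus>\<^bsub>corner A (E i)\<^esub>
        ?b \<otimes>\<^bsub>corner A (E i)\<^esub> \<one>\<^bsub>corner A (E i)\<^esub> = \<zero>\<^bsub>corner A (E i)\<^esub>"
      using b C.poly_at_pCons[OF b] C.poly_at_0[OF b] C.A.one_closed by (simp del: corner_sel)
    then have "(- z) \<odot> E i \<oplus> ?b \<otimes> E i = \<zero>" by simp
    moreover have "?b \<otimes> E i = ?b" using b D(1) by (simp add: A.m_comm)
    ultimately have "\<ominus> (z \<odot> E i) \<oplus> ?b = \<zero>" using D(1) by (simp add: smult_neg)
    then have "?b = z \<odot> E i"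
      using D(1) a minus_equality[of "?b" "\<ominus> (z \<odot> E i)"] by (simp add: a_comm)
    then show ?thesis by blast
  qed
  have "\<exists>c. a = lc A E r c" if a: "a \<in> carrier A" for a
  proof -
    obtain c where c: "\<And>i. i < r \<Longrightarrow> E i \<otimes> a = c i \<odot> E i" using mult[OF _ a] by (metis (no_types))
    have "a = a \<otimes> lc A E r (\<lambda>_. 1)" using max_orth_sum[OF E max] a by simp
    also have "\<dots> = lc A (\<lambda>i. a \<otimes> E i) r (\<lambda>_. 1)" by (rule mult_lc[OF a orth_idemsD(1)[OF E]])
    also have "\<dots> = lc A E r c"
      unfolding lc_def using orth_idemsD(1)[OF E] a c
      by (intro finsum_cong') (auto simp: A.m_comm)
    finally show ?thesis by blast
  qed
  then have "ordered_basis A E r"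
    unfolding ordered_basis_iff using orth_indep[OF E] orth_idemsD(1)[OF E] by blast
  then show ?thesis using E by blast
qed

section \<open>Isomorphisms\<close>

lemma lin_mapI:
  assumes "\<And>u. u \<in> carrier V \<Longrightarrow> f u \<in> carrier W"
    "\<And>u v. u \<in> carrier V \<Longrightarrow> v \<in> carrier V \<Longrightarrow> f (u \<oplus>\<^bsub>V\<^esub> v) = f u \<oplus>\<^bsub>W\<^esub> f v"
    "\<And>c u. u \<in> carrier V \<Longrightarrow> f (c \<odot>\<^bsub>V\<^esub> u) = c \<odot>\<^bsub>W\<^esub> f u"
  shows "f \<in> lin_map V W"
  using assms unfolding LinearCombinations.module_hom_def by auto

lemma lin_mapD:
  assumes "f \<in> lin_map V W"
  shows "u \<in> carrier V \<Longrightarrow> f u \<in> carrier W"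
    "u \<in> carrier V \<Longrightarrow> v \<in> carrier V \<Longrightarrow> f (u \<oplus>\<^bsub>V\<^esub> v) = f u \<oplus>\<^bsub>W\<^esub> f v"
    "u \<in> carrier V \<Longrightarrow> f (c \<odot>\<^bsub>V\<^esub> u) = c \<odot>\<^bsub>W\<^esub> f u"
  using assms unfolding LinearCombinations.module_hom_def by auto

lemma lin_map_inv:
  assumes "vspace V" and f: "f \<in> lin_map V W" and bij: "bij_betw f (carrier V) (carrier W)"
  shows "inv_into (carrier V) f \<in> lin_map W V"
proof -
  interpret V: vspace V by fact
  note D = lin_mapD[OF f]
  let ?g = "inv_into (carrier V) f"
  have g: "?g w \<in> carrier V" "f (?g w) = w" if "w \<in> carrier W" for w
    using that bij by (auto simp: bij_betw_def inv_into_into f_inv_into_f)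
  have eq: "?g w = v" if "v \<in> carrier V" "f v = w" for v w
    using that bij by (auto simp: bij_betw_def)
  show ?thesis
    by (rule lin_mapI) (use g D in \<open>auto intro!: eq\<close>)
qed

lemma algebra_isoI:
  assumes "bij_betw h (carrier A) (carrier B)" "h \<in> lin_map A B"
    "\<And>a b. a \<in> carrier A \<Longrightarrow> b \<in> carrier A \<Longrightarrow> h (a \<otimes>\<^bsub>A\<^esub> b) = h a \<otimes>\<^bsub>B\<^esub> h b"
    "h \<one>\<^bsub>A\<^esub> = \<one>\<^bsub>B\<^esub>"
  shows "algebra_iso A B"
proof -
  have "h \<in> ring_iso A B"
    unfolding ring_iso_def using assms lin_mapD[OF assms(2)] by (auto intro!: ring_hom_memI)
  then show ?thesis using assms(2) unfolding algebra_iso_def by blast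
qed

lemma algebra_isoE:
  assumes "algebra_iso A B"
  obtains h where "bij_betw h (carrier A) (carrier B)" "h \<in> lin_map A B"
    "\<And>a b. a \<in> carrier A \<Longrightarrow> b \<in> carrier A \<Longrightarrow> h (a \<otimes>\<^bsub>A\<^esub> b) = h a \<otimes>\<^bsub>B\<^esub> h b"
    "h \<one>\<^bsub>A\<^esub> = \<one>\<^bsub>B\<^esub>"
  using assms unfolding algebra_iso_def ring_iso_def by (auto simp: ring_hom_mult ring_hom_one)

lemma algebra_iso_refl: "algebra_iso A A"
  by (rule algebra_isoI[of "\<lambda>a. a"]) (auto intro: lin_mapI simp: bij_betw_def)

lemma algebra_iso_sym:
  assumes "kalg A" "algebra_iso A B"
  shows "algebra_iso B A"
proof -
  interpret kalg A by fact
  obtain h where h: "bij_betw h (carrier A) (carrier B)" "h \<in> lin_map A B"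
    "\<And>a b. a \<in> carrier A \<Longrightarrow> b \<in> carrier A \<Longrightarrow> h (a \<otimes>\<^bsub>A\<^esub> b) = h a \<otimes>\<^bsub>B\<^esub> h b"
    "h \<one>\<^bsub>A\<^esub> = \<one>\<^bsub>B\<^esub>"
    using algebra_isoE[OF assms(2)] by blast
  let ?g = "inv_into (carrier A) h"
  have g: "?g w \<in> carrier A" "h (?g w) = w" if "w \<in> carrier B" for w
    using that h(1) by (auto simp: bij_betw_def inv_into_into f_inv_into_f)
  have eq: "?g w = v" if "v \<in> carrier A" "h v = w" for v w
    using that h(1) by (auto simp: bij_betw_def)
  show ?thesis
    by (rule algebra_isoI[of ?g])
      (use h g bij_betw_inv_into lin_map_inv[OF vspace_axioms h(2,1)] in \<open>auto intro!: eq\<close>)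
qed

lemma algebra_iso_trans:
  assumes "algebra_iso A B" "algebra_iso B C"
  shows "algebra_iso A C"
proof -
  obtain h where h: "bij_betw h (carrier A) (carrier B)" "h \<in> lin_map A B"
    "\<And>a b. a \<in> carrier A \<Longrightarrow> b \<in> carrier A \<Longrightarrow> h (a \<otimes>\<^bsub>A\<^esub> b) = h a \<otimes>\<^bsub>B\<^esub> h b"
    "h \<one>\<^bsub>A\<^esub> = \<one>\<^bsub>B\<^esub>"
    using algebra_isoE[OF assms(1)] by blast
  obtain k where k: "bij_betw k (carrier B) (carrier C)" "k \<in> lin_map B C"
    "\<And>a b. a \<in> carrier B \<Longrightarrow> b \<in> carrier B \<Longrightarrow> k (a \<otimes>\<^bsub>B\<^esub> b) = k a \<otimes>\<^bsub>C\<^esub> k b"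
    "k \<one>\<^bsub>B\<^esub> = \<one>\<^bsub>C\<^esub>"
    using algebra_isoE[OF assms(2)] by blast
  note D = lin_mapD[OF h(2)] lin_mapD[OF k(2)]
  show ?thesis
  proof (rule algebra_isoI[of "\<lambda>a. k (h a)"])
    show "bij_betw (\<lambda>a. k (h a)) (carrier A) (carrier C)"
      using bij_betw_trans[OF h(1) k(1)] by (simp add: comp_def)
    show "(\<lambda>a. k (h a)) \<in> lin_map A C" by (rule lin_mapI) (auto simp: D)
  qed (simp_all add: D h(3,4) k(3,4))
qed

section \<open>The nondegenerate locus\<close>

text \<open>Structure constants of any binary operation on \<open>V\<close>; both \<open>act\<close>
  and the transport of an abstract product have this shape.\<close>

definition struct_of ::
    "('k::field, 'v) module \<Rightarrow> (nat \<Rightarrow> 'v) \<Rightarrow> nat \<Rightarrow> ('v \<Rightarrow> 'v \<Rightarrow> 'v) \<Rightarrow> 'k strconst" where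
  "struct_of V e n B = (\<lambda>i j l. if i < n \<and> j < n \<and> l < n then coord V e n (B (e i) (e j)) l else 0)"

lemma act_eq: "act V e n g x = struct_of V e n
    (\<lambda>u v. g (mu V e n x (inv_into (carrier V) g u) (inv_into (carrier V) g v)))"
  unfolding act_def struct_of_def ..

lemma struct_of_strconsts: "struct_of V e n B \<in> strconsts n"
  unfolding struct_of_def strconsts_def by auto

lemma alg_of_sel [simp]:
  "carrier (alg_of V e n x) = carrier V" "ring.zero (alg_of V e n x) = ring.zero V"
  "ring.add (alg_of V e n x) = ring.add V" "module.smult (alg_of V e n x) = module.smult V"
  "monoid.mult (alg_of V e n x) = mu V e n x"
  unfolding alg_of_def by simp_all

text \<open>Only product and identity distinguish \<open>alg_of V e n x\<close> from
  \<open>V\<close>, so linear algebra carries over unchanged.\<close>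

lemma lc_alg_of [simp]: "lc (alg_of V e n x) = lc V"
  unfolding lc_def finsum_def alg_of_def by (intro ext) simp

lemma indep_alg_of [simp]: "indep (alg_of V e n x) = indep V"
  unfolding indep_def by (intro ext) simp

lemma lin_map_alg_of [simp]: "lin_map (alg_of V e n x) W = lin_map V W" "lin_map W (alg_of V e n x) = lin_map W V"
  unfolding LinearCombinations.module_hom_def by simp_all

context based
begin

lemma one_alg_of:
  assumes "u \<in> carrier V" "\<And>v. v \<in> carrier V \<Longrightarrow> mu V e n x u v = v"
    "\<And>v. v \<in> carrier V \<Longrightarrow> mu V e n x v u = v"
  shows "\<one>\<^bsub>alg_of V e n x\<^esub> = u"
proof -
  have "(THE u. u \<in> carrier V \<and> (\<forall>v\<in>carrier V. mu V e n x u v = v \<and> mu V e n x v u = v)) = u"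
  proof (rule the_equality)
    fix w assume w: "w \<in> carrier V \<and> (\<forall>v\<in>carrier V. mu V e n x w v = v \<and> mu V e n x v w = v)"
    have "w = mu V e n x u w" using assms(2)[of w] w by simp
    also have "\<dots> = u" using w assms(1) by blast
    finally show "w = u" .
  qed (use assms in blast)
  then show ?thesis unfolding alg_of_def by simp
qed

lemma kalg_alg_ofI:
  assumes "x \<in> Comm n" "u \<in> carrier V" "\<And>v. v \<in> carrier V \<Longrightarrow> mu V e n x u v = v"
  shows "kalg (alg_of V e n x)" "\<one>\<^bsub>alg_of V e n x\<^esub> = u"
proof -
  have x: "x \<in> strconsts n" using assms(1) unfolding Comm_def by blast
  have comm: "mu V e n x v w = mu V e n x w v" if "v \<in> carrier V" "w \<in> carrier V" for v w
    using assms(1) that unfolding Comm_iff[OF x] by blast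
  have assoc: "mu V e n x (mu V e n x v w) z = mu V e n x v (mu V e n x w z)"
    if "v \<in> carrier V" "w \<in> carrier V" "z \<in> carrier V" for v w z
    using assms(1) that unfolding Comm_iff[OF x] by blast
  show one: "\<one>\<^bsub>alg_of V e n x\<^esub> = u"
    by (rule one_alg_of) (use assms comm in auto)
  have ab: "abelian_group (alg_of V e n x)"
  proof (rule abelian_groupI)
    fix v assume "v \<in> carrier (alg_of V e n x)"
    then show "\<exists>w\<in>carrier (alg_of V e n x). w \<oplus>\<^bsub>alg_of V e n x\<^esub> v = \<zero>\<^bsub>alg_of V e n x\<^esub>"
      by (intro bexI[of _ "\<ominus> v"]) (auto simp: l_neg)
  qed (auto simp: a_ac)
  have cm: "comm_monoid (alg_of V e n x)"
    by (rule comm_monoidI) (use assms in \<open>auto simp: one assoc intro: comm\<close>)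
  have cr: "cring (alg_of V e n x)"
    by (rule cringI[OF ab cm]) (auto simp: mu_add_left)
  have "algebra class_ring (alg_of V e n x)"
    by (rule algebraI[OF class_cring.is_cring cr])
      (auto simp: smult_add_left smult_add_right smult_mult mu_smult_left)
  then show "kalg (alg_of V e n x)" unfolding kalg_iff .
qed

lemma kalg_alg_of_Comm:
  assumes "x \<in> strconsts n" "kalg (alg_of V e n x)"
  shows "x \<in> Comm n"
proof -
  interpret A: kalg "alg_of V e n x" by fact
  show ?thesis
    unfolding Comm_iff[OF assms(1)] using A.A.m_assoc A.A.m_comm by simp
qed

lemma ordered_basis_alg_of:
  assumes "kalg (alg_of V e n x)"
  shows "ordered_basis (alg_of V e n x) e n"
proof -
  interpret A: kalg "alg_of V e n x" by fact
  show ?thesis using basis unfolding A.ordered_basis_iff ordered_basis_iff by simp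
qed

lemma fin_dim_alg_of:
  assumes "kalg (alg_of V e n x)"
  shows "vectorspace.fin_dim class_ring (alg_of V e n x)" "vectorspace.dim class_ring (alg_of V e n x) = n"
proof -
  interpret A: kalg "alg_of V e n x" by fact
  show "vectorspace.fin_dim class_ring (alg_of V e n x)" "vectorspace.dim class_ring (alg_of V e n x) = n"
    using A.ordered_basis_dim[OF ordered_basis_alg_of[OF assms]] by auto
qed

lemma trace_eqI:
  assumes "Delta V e n x \<noteq> 0" "a \<in> carrier V" "b \<in> carrier V"
    "\<And>v. v \<in> carrier V \<Longrightarrow> Tr V e n (mu V e n x (mu V e n x v a)) = Tr V e n (mu V e n x (mu V e n x v b))"
  shows "a = b"
proof -
  have "a \<oplus> (- 1) \<odot> b = \<zero>"
  proof (rule trace_nondegenerate[OF assms(1)])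
    fix v assume v: "v \<in> carrier V"
    have "mu V e n x v (a \<oplus> (- 1) \<odot> b) = mu V e n x v a \<oplus> (- 1) \<odot> mu V e n x v b"
      using assms(2,3) lin_mapD[OF mu_lin_right] by simp
    then have "Tr V e n (mu V e n x (mu V e n x v (a \<oplus> (- 1) \<odot> b))) =
        Tr V e n (mu V e n x (mu V e n x v a)) - Tr V e n (mu V e n x (mu V e n x v b))"
      unfolding Tr_mu by (simp add: coord_add coord_smult algebra_simps sum_subtractf)
    then show "Tr V e n (mu V e n x (mu V e n x v (a \<oplus> (- 1) \<odot> b))) = 0"
      using assms(4)[OF v] by simp
  qed (use assms(2,3) in auto)
  then have "a \<oplus> \<ominus> b = \<zero>" using assms(3) by (simp add: smult_neg)
  then show ?thesis using assms(2,3) minus_equality[of a "\<ominus> b"] by simp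
qed

lemma U_Comm_imp_kalg:
  assumes "x \<in> U_Comm V e n"
  shows "kalg (alg_of V e n x)"
proof -
  let ?m = "mu V e n x"
  have x: "x \<in> Comm n" "Delta V e n x \<noteq> 0" using assms unfolding U_Comm_def by auto
  then have xs: "x \<in> strconsts n" unfolding Comm_def by blast
  have comm: "?m v w = ?m w v" if "v \<in> carrier V" "w \<in> carrier V" for v w
    using x(1) that unfolding Comm_iff[OF xs] by blast
  have assoc: "?m (?m v w) z = ?m v (?m w z)"
    if "v \<in> carrier V" "w \<in> carrier V" "z \<in> carrier V" for v w z
    using x(1) that unfolding Comm_iff[OF xs] by blast
  obtain u where u: "u \<in> carrier V" "\<And>v. v \<in> carrier V \<Longrightarrow> Tr V e n (?m (?m v u)) = Tr V e n (?m v)"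
    using trace_representable[OF x(2)] by blast
  have "?m u a = a" if a: "a \<in> carrier V" for a
  proof (rule trace_eqI[OF x(2)])
    fix v assume v: "v \<in> carrier V"
    \<comment> \<open>Pairing the product of \<open>u\<close> and \<open>a\<close> with
      \<open>v\<close> amounts to pairing \<open>u\<close> with the product of \<open>v\<close> and
      \<open>a\<close>. By the choice of \<open>u\<close> the result is the trace that also arises
      from pairing \<open>a\<close> with \<open>v\<close>.\<close>
    have "?m v (?m u a) = ?m (?m v a) u"
      using assoc[OF v a u(1)] comm[OF u(1) a] by simp
    then show "Tr V e n (?m (?m v (?m u a))) = Tr V e n (?m (?m v a))"
      using u(2)[of "?m v a"] by simp
  qed (use a in auto)
  then show ?thesis using kalg_alg_ofI(1)[OF x(1) u(1)] by blast
qed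

lemma U_Comm_imp_reduced:
  assumes "x \<in> U_Comm V e n"
  shows "reduced_alg (alg_of V e n x)"
  unfolding reduced_alg_def
proof (intro ballI impI)
  let ?m = "mu V e n x"
  interpret A: kalg "alg_of V e n x" using U_Comm_imp_kalg[OF assms] .
  have d: "Delta V e n x \<noteq> 0" using assms unfolding U_Comm_def by auto
  fix a assume "a \<in> carrier (alg_of V e n x)" "a \<otimes>\<^bsub>alg_of V e n x\<^esub> a = \<zero>\<^bsub>alg_of V e n x\<^esub>"
  then have a: "a \<in> carrier V" "?m a a = \<zero>" by auto
  have z: "?m v \<zero> = \<zero>" "?m \<zero> v = \<zero>" if "v \<in> carrier V" for v
    using A.A.r_null[of v] A.A.l_null[of v] that by auto
  have as: "?m (?m v w) t = ?m v (?m w t)"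
    if "v \<in> carrier V" "w \<in> carrier V" "t \<in> carrier V" for v w t
    using A.A.m_assoc[of v w t] that by simp
  have co: "?m v w = ?m w v" if "v \<in> carrier V" "w \<in> carrier V" for v w
    using A.A.m_comm[of v w] that by simp
  have "a = \<zero>"
  proof (rule trace_nondegenerate[OF d a(1)])
    fix v assume v: "v \<in> carrier V"
    have va: "?m (?m v a) (?m v a) = \<zero>"
    proof -
      \<comment> \<open>Commutativity brings the two factors \<open>a\<close> together.\<close>
      have "?m (?m v a) (?m v a) = ?m (?m v a) (?m a v)" using co[OF v a(1)] by simp
      also have "\<dots> = ?m v (?m a (?m a v))" using as v a(1) by simp
      also have "?m a (?m a v) = ?m (?m a a) v" using as v a(1) by simp
      finally show ?thesis using a(2) z v by simp
    qed
    show "Tr V e n (?m (?m v a)) = 0"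
    proof (rule Tr_square_zero[OF mu_lin_right])
      fix w assume w: "w \<in> carrier V"
      have "?m (?m v a) (?m (?m v a) w) = ?m (?m (?m v a) (?m v a)) w"
        using as[of "?m v a" "?m v a" w] w by simp
      then show "?m (?m v a) (?m (?m v a) w) = \<zero>" using va z w by simp
    qed
  qed
  then show "a = \<zero>\<^bsub>alg_of V e n x\<^esub>" by simp
qed

end

lemma U_Comm_iff:
  fixes V :: "('k::field_char_0, 'v) module"
  assumes "based V e n" "x \<in> strconsts n"
  shows "x \<in> U_Comm V e n \<longleftrightarrow> kalg (alg_of V e n x) \<and> reduced_alg (alg_of V e n x)"
proof
  interpret based V e n by fact
  assume "x \<in> U_Comm V e n"
  then show "kalg (alg_of V e n x) \<and> reduced_alg (alg_of V e n x)"
    using U_Comm_imp_kalg U_Comm_imp_reduced by blast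
next
  interpret based V e n by fact
  assume *: "kalg (alg_of V e n x) \<and> reduced_alg (alg_of V e n x)"
  then interpret A: kalg "alg_of V e n x" by blast
  let ?m = "mu V e n x"
  have "Delta V e n x \<noteq> 0"
  proof
    assume "Delta V e n x = 0"
    then obtain u where u: "u \<in> carrier V" "u \<noteq> \<zero>\<^bsub>V\<^esub>"
        "\<And>v. v \<in> carrier V \<Longrightarrow> Tr V e n (?m (?m v u)) = 0"
      using trace_radical by blast
    obtain b where b: "b \<in> carrier V" "?m (?m u b) (?m u b) = ?m u b" "?m u b \<noteq> \<zero>\<^bsub>V\<^esub>"
      using A.idempotent_multiple[OF fin_dim_alg_of(1), of u] u * by auto
    have f: "?m u b = ?m b u" using A.A.m_comm[of u b] u(1) b(1) by simp
    have t: "Tr V e n (?m (?m u b)) = 0" using u(3)[OF b(1)] f by simp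
    \<comment> \<open>Multiplication by the idempotent \<open>?m u b\<close> is an idempotent map of
      trace 0, hence zero in characteristic 0. Its value at \<open>?m u b\<close> itself contradicts
      \<open>?m u b\<close> being a nonzero idempotent.\<close>
    have "?m (?m u b) (?m u b) = \<zero>\<^bsub>V\<^esub>"
    proof (rule Tr_idempotent[OF _ mu_lin_right _ t])
      fix v assume "v \<in> carrier V"
      then show "?m (?m u b) (?m (?m u b) v) = ?m (?m u b) v"
        using A.A.m_assoc[of "?m u b" "?m u b" v] b(2) by simp
    qed auto
    then show False using b by simp
  qed
  then show "x \<in> U_Comm V e n"
    using kalg_alg_of_Comm[OF assms(2)] * unfolding U_Comm_def by blast
qed

section \<open>Transport of structure and orbits\<close>

context based
begin

text \<open>A bilinear map is determined by its values on pairs of basis vectors; these are all that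
  \<open>struct_of\<close> records.\<close>

lemma mu_struct_of:
  assumes "\<And>u. u \<in> carrier V \<Longrightarrow> B u \<in> lin_map V V" "\<And>v. v \<in> carrier V \<Longrightarrow> (\<lambda>u. B u v) \<in> lin_map V V"
    "u \<in> carrier V" "v \<in> carrier V"
  shows "mu V e n (struct_of V e n B) u v = B u v"
proof -
  let ?m = "mu V e n (struct_of V e n B)"
  have 1: "?m (e i) (e j) = B (e i) (e j)" if "i < n" "j < n" for i j
    using that lin_mapD(1)[OF assms(1)]
    by (intro coord_eqI) (auto simp: coord_mu_e struct_of_def)
  have 2: "?m (e i) v = B (e i) v" if "i < n" for i
    by (rule lin_map_eqI[OF vspace_axioms mu_lin_right assms(1)]) (use that assms 1 in auto)
  show ?thesis
    by (rule lin_map_eqI[OF vspace_axioms mu_lin_left assms(2)]) (use assms 2 in auto)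
qed

text \<open>With \<open>h\<close> in \<open>GL V\<close> this describes the action; with
  \<open>h\<close> identifying an abstract algebra with \<open>V\<close> it produces a point
  carrying that algebra.\<close>

lemma struct_of_transport:
  assumes "kalg A" "h \<in> lin_map A V" "bij_betw h (carrier A) (carrier V)"
    and x: "x = struct_of V e n (\<lambda>u v. h (inv_into (carrier A) h u \<otimes>\<^bsub>A\<^esub> inv_into (carrier A) h v))"
    and ab: "a \<in> carrier A" "b \<in> carrier A"
  shows "h (a \<otimes>\<^bsub>A\<^esub> b) = mu V e n x (h a) (h b)"
proof -
  interpret A: kalg A by fact
  let ?g = "inv_into (carrier A) h"
  note H = lin_mapD[OF assms(2)]
  note G = lin_mapD[OF lin_map_inv[OF A.vspace_axioms assms(2,3)]]
  have gh: "?g (h c) = c" if "c \<in> carrier A" for c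
    using that assms(3) by (auto simp: bij_betw_def)
  have "mu V e n x (h a) (h b) = h (?g (h a) \<otimes>\<^bsub>A\<^esub> ?g (h b))"
    unfolding x
    by (rule mu_struct_of; (rule lin_mapI)?)
      (use ab in \<open>auto simp: H G A.A.r_distr A.A.l_distr A.smult_mult_left A.smult_mult_right\<close>)
  then show ?thesis using gh ab by simp
qed

text \<open>Every element of \<open>V\<close> is an image under \<open>h\<close>, so associativity,
  commutativity, the identity and reducedness pass from \<open>A\<close> to \<open>V\<close>.
  Membership in \<open>Comm n\<close> is thus a consequence and not a premise.\<close>

lemma alg_of_transport:
  assumes "kalg A" "h \<in> lin_map A V" "bij_betw h (carrier A) (carrier V)" "x \<in> strconsts n"
    and mult: "\<And>a b. a \<in> carrier A \<Longrightarrow> b \<in> carrier A \<Longrightarrow> h (a \<otimes>\<^bsub>A\<^esub> b) = mu V e n x (h a) (h b)"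
  shows "kalg (alg_of V e n x)" "algebra_iso A (alg_of V e n x)"
    "reduced_alg A \<Longrightarrow> reduced_alg (alg_of V e n x)"
proof -
  interpret A: kalg A by fact
  note H = lin_mapD[OF assms(2)]
  have sur: "\<exists>a\<in>carrier A. v = h a" if "v \<in> carrier V" for v
    using that assms(3) by (auto simp: bij_betw_def)
  have C: "x \<in> Comm n"
    unfolding Comm_iff[OF assms(4)]
  proof (intro conjI ballI)
    fix u v w assume "u \<in> carrier V" "v \<in> carrier V" "w \<in> carrier V"
    then obtain a b c where abc: "a \<in> carrier A" "b \<in> carrier A" "c \<in> carrier A" "u = h a" "v = h b" "w = h c"
      using sur by meson
    then show "mu V e n x (mu V e n x u v) w = mu V e n x u (mu V e n x v w)"
      by (simp add: mult[symmetric] A.A.m_assoc)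
  next
    fix u v assume "u \<in> carrier V" "v \<in> carrier V"
    then obtain a b where "a \<in> carrier A" "b \<in> carrier A" "u = h a" "v = h b"
      using sur by meson
    then show "mu V e n x u v = mu V e n x v u"
      by (simp add: mult[symmetric] A.A.m_comm)
  qed
  have "mu V e n x (h \<one>\<^bsub>A\<^esub>) v = v" if v: "v \<in> carrier V" for v
  proof -
    obtain a where a: "a \<in> carrier A" "v = h a" using sur[OF v] by blast
    then show ?thesis using mult[of "\<one>\<^bsub>A\<^esub>" a] by simp
  qed
  note K = kalg_alg_ofI[OF C H(1)[OF A.A.one_closed] this]
  show "kalg (alg_of V e n x)" using K(1) .
  show "algebra_iso A (alg_of V e n x)"
    by (rule algebra_isoI[of h]) (use assms(2,3) mult K(2) in auto)
  have h0: "h \<zero>\<^bsub>A\<^esub> = \<zero>" using H(3)[of "\<zero>\<^bsub>A\<^esub>" 0] H(1)[of "\<zero>\<^bsub>A\<^esub>"] by simp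
  assume red: "reduced_alg A"
  show "reduced_alg (alg_of V e n x)"
    unfolding reduced_alg_def
  proof (intro ballI impI)
    fix v assume "v \<in> carrier (alg_of V e n x)" "v \<otimes>\<^bsub>alg_of V e n x\<^esub> v = \<zero>\<^bsub>alg_of V e n x\<^esub>"
    then have v: "v \<in> carrier V" "mu V e n x v v = \<zero>" by auto
    obtain a where a: "a \<in> carrier A" "v = h a" using sur[OF v(1)] by blast
    then have "h (a \<otimes>\<^bsub>A\<^esub> a) = h \<zero>\<^bsub>A\<^esub>" using v(2) mult[of a a] h0 by simp
    then have "a \<otimes>\<^bsub>A\<^esub> a = \<zero>\<^bsub>A\<^esub>"
      using assms(3) a(1) A.A.m_closed[OF a(1) a(1)] A.zero_closed unfolding bij_betw_def inj_on_def by blast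
    then have "a = \<zero>\<^bsub>A\<^esub>" using reduced_algD[OF red] a(1) by blast
    then show "v = \<zero>\<^bsub>alg_of V e n x\<^esub>" using a(2) h0 by simp
  qed
qed

text \<open>Multiplicativity of \<open>g\<close> takes the place of the inverse of \<open>g\<close>
  that appears in \<open>act\<close>; in this form orbits can be compared with isomorphisms.\<close>

lemma orbit_iff:
  assumes "kalg (alg_of V e n x)"
  shows "y \<in> orbit V e n x \<longleftrightarrow> y \<in> strconsts n \<and>
    (\<exists>g\<in>GL V. \<forall>u\<in>carrier V. \<forall>v\<in>carrier V. g (mu V e n x u v) = mu V e n y (g u) (g v))"
proof
  assume "y \<in> orbit V e n x"
  then obtain g where g: "g \<in> GL V" "y = act V e n g x" unfolding orbit_def by blast
  have "g (mu V e n x u v) = mu V e n y (g u) (g v)" if "u \<in> carrier V" "v \<in> carrier V" for u v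
    using struct_of_transport[OF assms, of g y u v] g that unfolding act_eq GL_def by simp
  then show "y \<in> strconsts n \<and>
    (\<exists>g\<in>GL V. \<forall>u\<in>carrier V. \<forall>v\<in>carrier V. g (mu V e n x u v) = mu V e n y (g u) (g v))"
    using g struct_of_strconsts unfolding act_eq by blast
next
  assume "y \<in> strconsts n \<and>
    (\<exists>g\<in>GL V. \<forall>u\<in>carrier V. \<forall>v\<in>carrier V. g (mu V e n x u v) = mu V e n y (g u) (g v))"
  then obtain g where y: "y \<in> strconsts n" and g: "g \<in> GL V"
    and m: "\<And>u v. u \<in> carrier V \<Longrightarrow> v \<in> carrier V \<Longrightarrow> g (mu V e n x u v) = mu V e n y (g u) (g v)"
    by blast
  have gb: "bij_betw g (carrier V) (carrier V)" and gl: "g \<in> lin_map V V"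
    using g unfolding GL_def by auto
  let ?z = "act V e n g x" and ?g = "inv_into (carrier V) g"
  have m': "g (mu V e n x u v) = mu V e n ?z (g u) (g v)" if "u \<in> carrier V" "v \<in> carrier V" for u v
    using struct_of_transport[OF assms, of g ?z u v] gb gl that unfolding act_eq by simp
  \<comment> \<open>\<open>g\<close> carries \<open>mu V e n x\<close> to both products and is
    surjective, so they agree on basis vectors.\<close>
  have "?z = y"
  proof (rule mu_determines[OF _ y])
    show "?z \<in> strconsts n" unfolding act_eq by (rule struct_of_strconsts)
    fix i j assume ij: "i < n" "j < n"
    have gi: "?g v \<in> carrier V" "g (?g v) = v" if "v \<in> carrier V" for v
      using that gb by (auto simp: bij_betw_def inv_into_into f_inv_into_f)
    show "mu V e n ?z (e i) (e j) = mu V e n y (e i) (e j)"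
      using m[of "?g (e i)" "?g (e j)"] m'[of "?g (e i)" "?g (e j)"] gi e_in ij by simp
  qed
  then show "y \<in> orbit V e n x" using g unfolding orbit_def by blast
qed

lemma mem_orbit_self:
  assumes "kalg (alg_of V e n x)" "x \<in> strconsts n"
  shows "x \<in> orbit V e n x"
proof -
  have "(\<lambda>v. v) \<in> GL V" unfolding GL_def by (auto intro: lin_mapI simp: bij_betw_def)
  then show ?thesis unfolding orbit_iff[OF assms(1)] using assms(2) by (intro conjI bexI[of _ "\<lambda>v. v"]) auto
qed

lemma orbit_kalg:
  assumes "kalg (alg_of V e n x)" "y \<in> orbit V e n x"
  shows "kalg (alg_of V e n y)" "algebra_iso (alg_of V e n x) (alg_of V e n y)"
    "reduced_alg (alg_of V e n x) \<Longrightarrow> reduced_alg (alg_of V e n y)" "y \<in> strconsts n"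
proof -
  obtain g where y: "y \<in> strconsts n" and g: "g \<in> GL V"
    and m: "\<And>u v. u \<in> carrier V \<Longrightarrow> v \<in> carrier V \<Longrightarrow> g (mu V e n x u v) = mu V e n y (g u) (g v)"
    using assms(2) unfolding orbit_iff[OF assms(1)] by blast
  note T = alg_of_transport[OF assms(1) _ _ y, of g]
  show "kalg (alg_of V e n y)" "algebra_iso (alg_of V e n x) (alg_of V e n y)"
    "reduced_alg (alg_of V e n x) \<Longrightarrow> reduced_alg (alg_of V e n y)"
    using T g m unfolding GL_def by auto
  show "y \<in> strconsts n" by fact
qed

text \<open>Given isomorphisms \<open>h\<close> and \<open>k\<close> to \<open>A\<close> from the
  algebras of \<open>x\<close> and \<open>y\<close>, following \<open>h\<close> by the inverse of
  \<open>k\<close> gives an element of \<open>GL V\<close> that carries one product to the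
  other.\<close>

lemma locus_of_eq_orbit:
  assumes x: "kalg (alg_of V e n x)" and A: "kalg A" and iso: "algebra_iso (alg_of V e n x) A"
  shows "locus_of V e n A = orbit V e n x"
proof (intro equalityI subsetI)
  fix y assume "y \<in> locus_of V e n A"
  then have y: "y \<in> Comm n" "algebra_iso (alg_of V e n y) A" unfolding locus_of_def by auto
  then have ys: "y \<in> strconsts n" unfolding Comm_def by blast
  obtain h where h: "bij_betw h (carrier (alg_of V e n x)) (carrier A)" "h \<in> lin_map (alg_of V e n x) A"
    "\<And>a b. a \<in> carrier (alg_of V e n x) \<Longrightarrow> b \<in> carrier (alg_of V e n x) \<Longrightarrow>
      h (a \<otimes>\<^bsub>alg_of V e n x\<^esub> b) = h a \<otimes>\<^bsub>A\<^esub> h b" "h \<one>\<^bsub>alg_of V e n x\<^esub> = \<one>\<^bsub>A\<^esub>"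
    using algebra_isoE[OF iso] by blast
  obtain k where k: "bij_betw k (carrier (alg_of V e n y)) (carrier A)" "k \<in> lin_map (alg_of V e n y) A"
    "\<And>a b. a \<in> carrier (alg_of V e n y) \<Longrightarrow> b \<in> carrier (alg_of V e n y) \<Longrightarrow>
      k (a \<otimes>\<^bsub>alg_of V e n y\<^esub> b) = k a \<otimes>\<^bsub>A\<^esub> k b" "k \<one>\<^bsub>alg_of V e n y\<^esub> = \<one>\<^bsub>A\<^esub>"
    using algebra_isoE[OF y(2)] by blast
  let ?k = "inv_into (carrier V) k"
  have hb: "bij_betw h (carrier V) (carrier A)" "h \<in> lin_map V A"
    and kb: "bij_betw k (carrier V) (carrier A)" "k \<in> lin_map V A"
    using h k by auto
  have kl: "?k \<in> lin_map A V" using lin_map_inv[OF vspace_axioms kb(2,1)] .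
  have kinv: "?k w \<in> carrier V" "k (?k w) = w" if "w \<in> carrier A" for w
    using that kb(1) by (auto simp: bij_betw_def inv_into_into f_inv_into_f)
  have keq: "?k w = v" if "v \<in> carrier V" "k v = w" for v w
    using that kb(1) by (auto simp: bij_betw_def)
  have "(\<lambda>u. ?k (h u)) \<in> GL V"
    unfolding GL_def
    using bij_betw_trans[OF hb(1) bij_betw_inv_into[OF kb(1)]]
    by (auto simp: comp_def intro!: lin_mapI simp: lin_mapD[OF hb(2)] lin_mapD[OF kl])
  moreover have "?k (h (mu V e n x u v)) = mu V e n y (?k (h u)) (?k (h v))"
    if "u \<in> carrier V" "v \<in> carrier V" for u v
    using h(3)[of u v] k(3)[of "?k (h u)" "?k (h v)"] kinv lin_mapD(1)[OF hb(2)] that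
    by (intro keq) auto
  ultimately show "y \<in> orbit V e n x"
    unfolding orbit_iff[OF x] using ys by (intro conjI bexI[of _ "\<lambda>u. ?k (h u)"]) auto
next
  fix y assume "y \<in> orbit V e n x"
  note K = orbit_kalg[OF x this]
  have "y \<in> Comm n" using kalg_alg_of_Comm K by blast
  moreover have "algebra_iso (alg_of V e n y) A"
    using algebra_iso_trans[OF algebra_iso_sym[OF x K(2)] iso] .
  ultimately show "y \<in> locus_of V e n A" unfolding locus_of_def by blast
qed

end

section \<open>Realising etale algebras as points\<close>

lemma exists_U_Comm_point:
  fixes V :: "('k::field_char_0, 'v) module" and A :: "('k, 'a) module"
  assumes "based V e n" "kalg A" "reduced_alg A" "ordered_basis A b n"
  shows "\<exists>x\<in>U_Comm V e n. algebra_iso (alg_of V e n x) A"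
proof -
  interpret based V e n by fact
  interpret A: kalg A by fact
  interpret B: based A b n using assms(4) ordered_basis_based by blast
  \<comment> \<open>Matches the basis \<open>b\<close> of \<open>A\<close> with the basis
    \<open>e\<close> of \<open>V\<close>.\<close>
  define h where "h a = lc V e n (B.cd a)" for a
  have h: "h \<in> lin_map A V"
  proof (rule lin_mapI)
    fix a b c assume a: "a \<in> carrier A"
    show "h a \<in> carrier V" unfolding h_def by auto
    have "B.cd (c \<odot>\<^bsub>A\<^esub> a) = (\<lambda>i. c * B.cd a i)" using a by (simp add: B.coord_smult fun_eq_iff)
    then show "h (c \<odot>\<^bsub>A\<^esub> a) = c \<odot>\<^bsub>V\<^esub> h a" unfolding h_def by (simp add: lc_smult)
    assume b: "b \<in> carrier A"
    have "B.cd (a \<oplus>\<^bsub>A\<^esub> b) = (\<lambda>i. B.cd a i + B.cd b i)" using a b by (simp add: B.coord_add fun_eq_iff)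
    then show "h (a \<oplus>\<^bsub>A\<^esub> b) = h a \<oplus>\<^bsub>V\<^esub> h b" unfolding h_def by (simp add: lc_add)
  qed
  have ch: "cd (h a) i = B.cd a i" if "i < n" for a i unfolding h_def by (rule coord_lc[OF that])
  have inj: "inj_on h (carrier A)"
    by (rule inj_onI, rule B.coord_eqI) (auto simp flip: ch)
  have sur: "v \<in> h ` carrier A" if v: "v \<in> carrier V" for v
  proof -
    have "v = h (lc A b n (cd v))"
      unfolding h_def using lc_coord[OF v] lc_cong[of n e e "cd v" "B.cd (lc A b n (cd v))"]
      by (simp add: B.coord_lc)
    then show ?thesis by auto
  qed
  have bij: "bij_betw h (carrier A) (carrier V)"
    unfolding bij_betw_def using inj sur lin_mapD(1)[OF h] by blast
  define x where "x = struct_of V e n (\<lambda>u v. h (inv_into (carrier A) h u \<otimes>\<^bsub>A\<^esub> inv_into (carrier A) h v))"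
  have xs: "x \<in> strconsts n" unfolding x_def by (rule struct_of_strconsts)
  note T = alg_of_transport[OF assms(2) h bij xs struct_of_transport[OF assms(2) h bij x_def]]
  have "x \<in> U_Comm V e n" unfolding U_Comm_iff[OF assms(1) xs] using T assms(3) by blast
  then show ?thesis using algebra_iso_sym[OF assms(2) T(2)] by blast
qed

text \<open>Reducedness is inherited from the fields and finite dimension from bases of the factors.
  The arguments run through the components of \<open>h\<close> and the embeddings
  \<open>\<iota> i\<close>, so all computations stay in \<open>A\<close> and in the factors, and the
  product serves only as a set of tuples with componentwise operations.\<close>

lemma finite_etaleD:
  fixes A :: "('k::field, 'a) module"
  assumes "finite_etale A"
  shows "kalg A" "vectorspace.fin_dim class_ring A" "reduced_alg A"
proof -
  show A: "kalg A" using assms unfolding finite_etale_def kalg_iff by blast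
  interpret A: kalg A by fact
  obtain r and L :: "nat \<Rightarrow> ('k, 'a) module" where L: "\<And>i. i < r \<Longrightarrow> finite_separable_extension (L i)"
    and iso: "algebra_iso A (product_algebra r L)"
    using assms unfolding finite_etale_def by blast
  let ?P = "product_algebra r L"
  obtain h where h: "bij_betw h (carrier A) (carrier ?P)" "h \<in> lin_map A ?P"
    "\<And>a b. a \<in> carrier A \<Longrightarrow> b \<in> carrier A \<Longrightarrow> h (a \<otimes>\<^bsub>A\<^esub> b) = h a \<otimes>\<^bsub>?P\<^esub> h b" "h \<one>\<^bsub>A\<^esub> = \<one>\<^bsub>?P\<^esub>"
    using algebra_isoE[OF iso] by blast
  have kL: "kalg (L i)" and fL: "field (L i)" and dL: "vectorspace.fin_dim class_ring (L i)" if "i < r" for i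
    using L[OF that] unfolding finite_separable_extension_def kalg_iff by auto
  note vL = kalg.axioms(1)[OF kL]
  have hc: "h a \<in> carrier ?P" if "a \<in> carrier A" for a using lin_mapD(1)[OF h(2) that] .
  have pr: "(\<lambda>a. h a i) \<in> lin_map A (L i)" if "i < r" for i
    using hc that lin_mapD(2,3)[OF h(2)]
    by (intro lin_mapI) (auto simp: product_algebra_def PiE_iff)
  have jinj: "a = b" if "a \<in> carrier A" "b \<in> carrier A" "\<And>i. i < r \<Longrightarrow> h a i = h b i" for a b
  proof -
    have "h a = h b"
      using hc[OF that(1)] hc[OF that(2)] that(3)
      by (intro ext) (auto simp: product_algebra_def PiE_iff extensional_def, metis)
    then show ?thesis using h(1) that(1,2) unfolding bij_betw_def inj_on_def by blast
  qed
  have p0: "h \<zero>\<^bsub>A\<^esub> i = \<zero>\<^bsub>L i\<^esub>" if "i < r" for i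
  proof -
    interpret Li: vspace "L i" using vL[OF that] .
    show ?thesis
      using lin_mapD(3)[OF pr[OF that], of "\<zero>\<^bsub>A\<^esub>" 0] lin_mapD(1)[OF pr[OF that], of "\<zero>\<^bsub>A\<^esub>"] by simp
  qed
  show "reduced_alg A"
    unfolding reduced_alg_def
  proof (intro ballI impI)
    fix a assume a: "a \<in> carrier A" "a \<otimes>\<^bsub>A\<^esub> a = \<zero>\<^bsub>A\<^esub>"
    show "a = \<zero>\<^bsub>A\<^esub>"
    proof (rule jinj)
      fix i assume i: "i < r"
      interpret Li: field "L i" using fL[OF i] .
      have "h a i \<otimes>\<^bsub>L i\<^esub> h a i = h (a \<otimes>\<^bsub>A\<^esub> a) i"
        using h(3)[OF a(1) a(1)] i by (simp add: product_algebra_def)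
      then have "h a i \<otimes>\<^bsub>L i\<^esub> h a i = \<zero>\<^bsub>L i\<^esub>" using a(2) p0[OF i] by simp
      then show "h a i = h \<zero>\<^bsub>A\<^esub> i"
        using Li.integral lin_mapD(1)[OF pr[OF i] a(1)] p0[OF i] by auto
    qed (use a in auto)
  qed
  \<comment> \<open>The preimage under \<open>h\<close> of the tuple concentrated at
    \<open>i\<close>: an embedding of the \<open>i\<close>-th factor into \<open>A\<close>.\<close>
  define \<iota> where "\<iota> i y = inv_into (carrier A) h (\<lambda>j\<in>{..<r}. if j = i then y else \<zero>\<^bsub>L j\<^esub>)" for i y
  have inP: "(\<lambda>j\<in>{..<r}. if j = i then y else \<zero>\<^bsub>L j\<^esub>) \<in> carrier ?P" if "y \<in> carrier (L i)" for i y
  proof -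
    have "\<zero>\<^bsub>L j\<^esub> \<in> carrier (L j)" if "j < r" for j
    proof -
      interpret Lj: kalg "L j" using kL[OF that] .
      show ?thesis by simp
    qed
    then show ?thesis using that by (auto simp: product_algebra_def)
  qed
  have \<iota>c: "\<iota> i y \<in> carrier A" if "y \<in> carrier (L i)" for i y
    unfolding \<iota>_def using inP[OF that] h(1) by (auto simp: bij_betw_def inv_into_into)
  have h\<iota>: "h (\<iota> i y) j = (if j = i then y else \<zero>\<^bsub>L j\<^esub>)" if "y \<in> carrier (L i)" "j < r" for i j y
    unfolding \<iota>_def using inP[OF that(1)] h(1) that(2) by (simp add: bij_betw_def f_inv_into_f)
  have \<iota>l: "\<iota> i \<in> lin_map (L i) A" if i: "i < r" for i
  proof (rule lin_mapI)
    interpret Li: kalg "L i" using kL[OF i] .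
    fix y z c assume y: "y \<in> carrier (L i)"
    show "\<iota> i y \<in> carrier A" using \<iota>c[OF y] .
    show "\<iota> i (c \<odot>\<^bsub>L i\<^esub> y) = c \<odot>\<^bsub>A\<^esub> \<iota> i y"
    proof (rule jinj)
      fix j assume j: "j < r"
      interpret Lj: kalg "L j" using kL[OF j] .
      show "h (\<iota> i (c \<odot>\<^bsub>L i\<^esub> y)) j = h (c \<odot>\<^bsub>A\<^esub> \<iota> i y) j"
        using h\<iota>[OF _ j] lin_mapD(3)[OF pr[OF j] \<iota>c[OF y]] y by simp
    qed (use y \<iota>c in auto)
    assume z: "z \<in> carrier (L i)"
    show "\<iota> i (y \<oplus>\<^bsub>L i\<^esub> z) = \<iota> i y \<oplus>\<^bsub>A\<^esub> \<iota> i z"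
    proof (rule jinj)
      fix j assume j: "j < r"
      interpret Lj: kalg "L j" using kL[OF j] .
      show "h (\<iota> i (y \<oplus>\<^bsub>L i\<^esub> z)) j = h (\<iota> i y \<oplus>\<^bsub>A\<^esub> \<iota> i z) j"
        using h\<iota>[OF _ j] lin_mapD(2)[OF pr[OF j] \<iota>c[OF y] \<iota>c[OF z]] y z by simp
    qed (use y z \<iota>c in auto)
  qed
  have "\<exists>b d. ordered_basis (L i) b d" if "i < r" for i
  proof -
    interpret Li: vspace "L i" using vL[OF that] .
    show ?thesis using Li.exists_ordered_basis[OF dL[OF that]] by blast
  qed
  then obtain b d where bd: "\<And>i. i < r \<Longrightarrow> ordered_basis (L i) (b i) (d i)" by metis
  define S where "S = (\<Union>i<r. (\<lambda>j. \<iota> i (b i j)) ` {..<d i})"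
  have bc: "b i j \<in> carrier (L i)" if "i < r" "j < d i" for i j
  proof -
    interpret Li: based "L i" "b i" "d i" using bd[OF that(1)] ordered_basis_based by blast
    show ?thesis using that by simp
  qed
  have S: "finite S" "S \<subseteq> carrier A" unfolding S_def using \<iota>c bc by auto
  have \<iota>S: "\<iota> i y \<in> A.span S" if "i < r" "y \<in> carrier (L i)" for i y
  proof -
    interpret Li: based "L i" "b i" "d i" using bd[OF that(1)] ordered_basis_based by blast
    have "\<iota> i y = lc A (\<lambda>j. \<iota> i (b i j)) (d i) (Li.cd y)"
      using lin_map_lc[OF Li.vspace_axioms A.vspace_axioms \<iota>l[OF that(1)], of "d i" "b i" "Li.cd y"]
        bc that Li.lc_coord[OF that(2)] by simp
    also have "\<dots> \<in> A.span S"
      by (rule A.lc_in_span[OF S(2)], rule A.span_mem) (use S that in \<open>auto simp: S_def\<close>)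
    finally show ?thesis .
  qed
  have "v \<in> A.span S" if v: "v \<in> carrier A" for v
  proof -
    have hv: "h v i \<in> carrier (L i)" if "i < r" for i using lin_mapD(1)[OF pr[OF that] v] .
    let ?w = "lc A (\<lambda>i. \<iota> i (h v i)) r (\<lambda>_. 1)"
    have wc: "?w \<in> carrier A" using \<iota>c hv by auto
    \<comment> \<open>Every element is the sum of its embedded components.\<close>
    have "v = ?w"
    proof (rule jinj[OF v wc])
      fix k assume k: "k < r"
      interpret Lk: kalg "L k" using kL[OF k] .
      have "h ?w k = lc (L k) (\<lambda>i. h (\<iota> i (h v i)) k) r (\<lambda>_. 1)"
        using lin_map_lc[OF A.vspace_axioms Lk.vspace_axioms pr[OF k]] \<iota>c hv by simp
      also have "\<dots> = lc (L k) (\<lambda>i. if i = k then h v k else \<zero>\<^bsub>L k\<^esub>) r (\<lambda>_. 1)"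
        using h\<iota>[OF hv k] hv k by (intro Lk.lc_cong) auto
      also have "\<dots> = h v k" using Lk.lc_single[OF k hv[OF k]] hv[OF k] by simp
      finally show "h v k = h ?w k" by simp
    qed
    also have "\<dots> \<in> A.span S" using \<iota>S hv by (intro A.lc_in_span[OF S(2)]) auto
    finally show ?thesis .
  qed
  then have "A.span S = carrier A" using A.span_is_subset2[OF S(2)] by blast
  then show "A.fin_dim" unfolding A.fin_dim_def using S by blast
qed

section \<open>Coordinatewise algebras\<close>

lemma kalg_coordinatewise: "kalg (coordinatewise_algebra n :: ('k::field, nat \<Rightarrow> 'k) module)"
proof -
  let ?A = "coordinatewise_algebra n :: ('k, nat \<Rightarrow> 'k) module"
  note defs = product_algebra_def base_algebra_def
  have ab: "abelian_group ?A"
  proof (rule abelian_groupI)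
    fix f assume "f \<in> carrier ?A"
    then show "\<exists>g\<in>carrier ?A. g \<oplus>\<^bsub>?A\<^esub> f = \<zero>\<^bsub>?A\<^esub>"
      by (intro bexI[of _ "\<lambda>i\<in>{..<n}. - f i"]) (auto simp: defs fun_eq_iff PiE_iff extensional_def)
  qed (auto simp: defs fun_eq_iff PiE_iff extensional_def)
  have cm: "comm_monoid ?A"
    by (rule comm_monoidI) (auto simp: defs fun_eq_iff PiE_iff extensional_def mult_ac)
  have cr: "cring ?A"
    by (rule cringI[OF ab cm]) (auto simp: defs fun_eq_iff PiE_iff extensional_def algebra_simps)
  have "algebra class_ring ?A"
    by (rule algebraI[OF class_cring.is_cring cr])
      (auto simp: defs fun_eq_iff PiE_iff extensional_def algebra_simps)
  then show ?thesis unfolding kalg_iff .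
qed

lemma reduced_coordinatewise: "reduced_alg (coordinatewise_algebra n :: ('k::field, nat \<Rightarrow> 'k) module)"
  unfolding reduced_alg_def
proof (intro ballI impI)
  let ?A = "coordinatewise_algebra n :: ('k, nat \<Rightarrow> 'k) module"
  fix f assume f: "f \<in> carrier ?A" "f \<otimes>\<^bsub>?A\<^esub> f = \<zero>\<^bsub>?A\<^esub>"
  have "f i = 0" if "i < n" for i
    using fun_cong[OF f(2), of i] that by (simp add: product_algebra_def base_algebra_def)
  then show "f = \<zero>\<^bsub>?A\<^esub>"
    using f(1) by (auto simp: product_algebra_def base_algebra_def fun_eq_iff PiE_iff extensional_def)
qed

lemma ordered_basis_coordinatewise:
  "ordered_basis (coordinatewise_algebra n :: ('k::field, nat \<Rightarrow> 'k) module)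
     (\<lambda>i. \<lambda>j\<in>{..<n}. if j = i then 1 else 0) n"
proof -
  let ?A = "coordinatewise_algebra n :: ('k, nat \<Rightarrow> 'k) module"
  let ?b = "\<lambda>i. \<lambda>j\<in>{..<n}. if j = i then 1 else (0::'k)"
  interpret kalg ?A by (rule kalg_coordinatewise)
  have b: "?b i \<in> carrier ?A" for i by (simp add: product_algebra_def base_algebra_def)
  have lc: "lc ?A ?b m c = (\<lambda>j\<in>{..<n}. if j < m then c j else 0)" for m c
  proof (induction m)
    case 0
    show ?case unfolding lc_empty by (simp add: product_algebra_def base_algebra_def)
  next
    case (Suc m)
    have "lc ?A ?b (Suc m) c = lc ?A ?b m c \<oplus>\<^bsub>?A\<^esub> c m \<odot>\<^bsub>?A\<^esub> ?b m" using b by (rule lc_Suc)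
    also have "\<dots> = (\<lambda>j\<in>{..<n}. if j < Suc m then c j else 0)"
      unfolding Suc by (auto simp: product_algebra_def base_algebra_def fun_eq_iff less_Suc_eq)
    finally show ?case .
  qed
  have lcn: "lc ?A ?b n c = (\<lambda>j\<in>{..<n}. c j)" for c unfolding lc by (auto simp: fun_eq_iff)
  have "indep ?A ?b n"
    unfolding indep_def
  proof (intro allI impI)
    fix c i assume "lc ?A ?b n c = \<zero>\<^bsub>?A\<^esub>" "i < n"
    then have "(\<lambda>j\<in>{..<n}. c j) i = (\<zero>\<^bsub>?A\<^esub>) i" unfolding lcn by simp
    then show "c i = 0" using \<open>i < n\<close> by (simp add: product_algebra_def base_algebra_def)
  qed
  moreover have "f = lc ?A ?b n f" if "f \<in> carrier ?A" for f
    using that unfolding lcn by (auto simp: product_algebra_def fun_eq_iff PiE_iff extensional_def)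
  ultimately show ?thesis unfolding ordered_basis_iff using b by blast
qed

text \<open>\<open>E i\<close> times \<open>a\<close> is the \<open>i\<close>-th coordinate of
  \<open>a\<close> times \<open>E i\<close>; hence the coordinates along \<open>E\<close> are
  multiplicative.\<close>

lemma iso_coordinatewise:
  fixes A :: "('k::field, 'a) module"
  assumes "kalg A" "orth_idems A E n" "ordered_basis A E n"
  shows "algebra_iso A (coordinatewise_algebra n)"
proof -
  interpret kalg A by fact
  interpret B: based A E n using assms(3) ordered_basis_based by blast
  let ?P = "coordinatewise_algebra n :: ('k, nat \<Rightarrow> 'k) module"
  note D = orth_idemsD[OF assms(2)]
  note defs = product_algebra_def base_algebra_def
  have Ea: "E i \<otimes>\<^bsub>A\<^esub> a = B.cd a i \<odot>\<^bsub>A\<^esub> E i" if "i < n" "a \<in> carrier A" for i a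
    using orth_mult_lc_self[OF assms(2) that(1), of "B.cd a"] B.lc_coord[OF that(2)] by simp
  have cEa: "B.cd (E i \<otimes>\<^bsub>A\<^esub> a) i = B.cd a i" if "i < n" "a \<in> carrier A" for i a
    using Ea[OF that] that D(1) by (simp add: B.coord_smult B.coord_e)
  define h where "h a = (\<lambda>i\<in>{..<n}. B.cd a i)" for a
  have mult: "B.cd (a \<otimes>\<^bsub>A\<^esub> b) i = B.cd a i * B.cd b i"
    if "i < n" "a \<in> carrier A" "b \<in> carrier A" for a b i
  proof -
    have "E i \<otimes>\<^bsub>A\<^esub> (a \<otimes>\<^bsub>A\<^esub> b) = (B.cd a i \<odot>\<^bsub>A\<^esub> E i) \<otimes>\<^bsub>A\<^esub> b"
      using Ea[OF that(1,2)] A.m_assoc[OF D(1)[OF that(1)] that(2,3)] by simp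
    also have "\<dots> = B.cd a i \<odot>\<^bsub>A\<^esub> (E i \<otimes>\<^bsub>A\<^esub> b)"
      using smult_mult_left[OF D(1)[OF that(1)] that(3)] .
    finally show ?thesis
      using cEa[OF that(1), of "a \<otimes>\<^bsub>A\<^esub> b"] cEa[OF that(1,3)] that D(1) by (simp add: B.coord_smult)
  qed
  have one: "B.cd \<one>\<^bsub>A\<^esub> i = 1" if "i < n" for i
    using cEa[OF that A.one_closed] D(1)[OF that] B.coord_e[OF that that] by simp
  have hc: "h a \<in> carrier ?P" for a by (auto simp: h_def defs)
  have inj: "inj_on h (carrier A)"
  proof (rule inj_onI, rule B.coord_eqI)
    fix a b i assume "h a = h b" "i < n"
    then have "h a i = h b i" by simp
    then show "B.cd a i = B.cd b i" using \<open>i < n\<close> unfolding h_def by simp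
  qed
  have sur: "f \<in> h ` carrier A" if "f \<in> carrier ?P" for f
  proof -
    have "h (lc A E n f) = f"
      using that unfolding h_def by (auto simp: defs B.coord_lc fun_eq_iff PiE_iff extensional_def)
    then show ?thesis using D(1) by (intro image_eqI[of _ _ "lc A E n f"]) auto
  qed
  show ?thesis
  proof (rule algebra_isoI[of h])
    show "bij_betw h (carrier A) (carrier ?P)"
      unfolding bij_betw_def using inj sur hc by blast
    show "h \<in> lin_map A ?P"
      by (rule lin_mapI) (auto simp: h_def defs B.coord_add B.coord_smult fun_eq_iff)
  qed (auto simp: h_def defs mult one fun_eq_iff)
qed

lemma U_Comm_closed_iso:
  fixes V :: "('k::field_char_0, 'v) module"
  assumes closed: "\<And>p :: 'k poly. Polynomial.degree p > 0 \<Longrightarrow> \<exists>z. poly p z = 0"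
    and "based V e n" "x \<in> U_Comm V e n"
  shows "algebra_iso (alg_of V e n x) (coordinatewise_algebra n)"
proof -
  interpret based V e n by fact
  have k: "kalg (alg_of V e n x)" and r: "reduced_alg (alg_of V e n x)"
    using U_Comm_imp_kalg U_Comm_imp_reduced assms(3) by auto
  interpret A: kalg "alg_of V e n x" by (rule k)
  obtain E m where E: "orth_idems (alg_of V e n x) E m" "ordered_basis (alg_of V e n x) E m"
    using alg_closed_idempotent_basis[OF closed k fin_dim_alg_of(1)[OF k] r] by blast
  have "m = n" using A.ordered_basis_dim[OF E(2)] fin_dim_alg_of(2)[OF k] by simp
  then show ?thesis using iso_coordinatewise[OF k] E by blast
qed

text \<open>Keeps the statements about geometric orbits from being vacuous: without a point over the
  base field the union of these orbits would be empty.\<close>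

lemma U_Comm_nonempty:
  fixes V :: "('k::field_char_0, 'v) module"
  assumes "based V e n"
  shows "\<exists>x. x \<in> U_Comm V e n"
  using exists_U_Comm_point[OF assms kalg_coordinatewise reduced_coordinatewise ordered_basis_coordinatewise]
  by blast

lemma U_Comm_strconsts: "x \<in> U_Comm V e n \<Longrightarrow> x \<in> strconsts n"
  unfolding U_Comm_def Comm_def by blast

lemma orbit_subset_U_Comm:
  fixes V :: "('k::field_char_0, 'v) module"
  assumes "based V e n" "x \<in> U_Comm V e n"
  shows "orbit V e n x \<subseteq> U_Comm V e n"
proof
  interpret based V e n by fact
  fix y assume "y \<in> orbit V e n x"
  note K = orbit_kalg[OF U_Comm_imp_kalg[OF assms(2)] this]
  show "y \<in> U_Comm V e n"
    unfolding U_Comm_iff[OF assms(1) K(4)] using K(1,3) U_Comm_imp_reduced[OF assms(2)] by blast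
qed

lemma U_Comm_closed_orbit:
  fixes V :: "('k::field_char_0, 'v) module"
  assumes closed: "\<And>p :: 'k poly. Polynomial.degree p > 0 \<Longrightarrow> \<exists>z. poly p z = 0"
    and b: "based V e n" and x: "x \<in> U_Comm V e n"
  shows "orbit V e n x = U_Comm V e n"
proof
  interpret based V e n by fact
  show "orbit V e n x \<subseteq> U_Comm V e n" by (rule orbit_subset_U_Comm[OF b x])
  have "orbit V e n x = locus_of V e n (coordinatewise_algebra n :: ('k, nat \<Rightarrow> 'k) module)"
    using locus_of_eq_orbit[OF U_Comm_imp_kalg[OF x] kalg_coordinatewise U_Comm_closed_iso[OF closed b x]] by simp
  moreover have "y \<in> locus_of V e n (coordinatewise_algebra n :: ('k, nat \<Rightarrow> 'k) module)" if "y \<in> U_Comm V e n" for y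
    using U_Comm_closed_iso[OF closed b that] that unfolding locus_of_def U_Comm_def by blast
  ultimately show "U_Comm V e n \<subseteq> orbit V e n x" by blast
qed

section \<open>Geometric points and openness\<close>

lemma unit_vec_basis: "based (module_vec TYPE('K::field) n) (unit_vec n) n"
proof -
  interpret vec_space "TYPE('K)" n .
  have "vectorspace class_ring (module_vec TYPE('K) n)" by unfold_locales
  moreover have "inj_on (unit_vec n :: nat \<Rightarrow> 'K vec) {..<n}"
    by (rule inj_onI) (metis index_unit_vec(1) lessThan_iff zero_neq_one)
  moreover have "unit_vec n ` {..<n} = (set (unit_vecs n) :: 'K vec set)"
    unfolding unit_vecs_def by auto
  ultimately show ?thesis
    unfolding ordered_basis_based[symmetric] ordered_basis_def using unit_vecs_basis by auto
qed

text \<open>The equations of \<open>Comm\<close> and the entries of the Gram matrix have integer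
  coefficients, so they commute with the embedding \<open>to_ac\<close>, whose injectivity keeps the
  determinant nonzero.\<close>

lemma U_Comm_to_ac:
  fixes V :: "('k::field, 'v) module"
  assumes "based V e n" "x \<in> U_Comm V e n"
  shows "(\<lambda>i j l. to_ac (x i j l)) \<in> U_Comm_geom n"
proof -
  interpret based V e n by fact
  interpret W: based "module_vec TYPE('k alg_closure) n" "unit_vec n" n by (rule unit_vec_basis)
  interpret H: comm_ring_hom "to_ac :: 'k \<Rightarrow> 'k alg_closure" by unfold_locales auto
  let ?y = "\<lambda>i j l. to_ac (x i j l)"
  have x: "x \<in> Comm n" "det (gram n x) \<noteq> 0"
    using assms(2) unfolding U_Comm_def Delta_eq by auto
  have "?y \<in> Comm n"
    using x(1) unfolding Comm_def strconsts_def
    by (auto simp flip: to_ac_mult to_ac_sum)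
  moreover have "gram n ?y = map_mat to_ac (gram n x)"
    by (rule eq_matI) (auto simp: trace_form_def to_ac_sum)
  then have "det (gram n ?y) \<noteq> 0" using x(2) by simp
  ultimately show ?thesis unfolding U_Comm_def W.Delta_eq by blast
qed

lemma poly_funs_sum:
  assumes "\<iota> 0 = 0" "\<And>a. a \<in> S \<Longrightarrow> f a \<in> poly_funs \<iota> n"
  shows "(\<lambda>x. \<Sum>a\<in>S. f a x) \<in> poly_funs \<iota> n"
  using assms(2)
proof (induction S rule: infinite_finite_induct)
  case (insert a S)
  then have "(\<lambda>x. f a x + (\<Sum>a\<in>S. f a x)) \<in> poly_funs \<iota> n" by (intro poly_funs.add) auto
  then show ?case using insert by simp
qed (use poly_funs.const[of \<iota> 0 n] assms(1) in simp_all)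

lemma poly_funs_prod:
  assumes "\<iota> 1 = 1" "\<And>a. a \<in> S \<Longrightarrow> f a \<in> poly_funs \<iota> n"
  shows "(\<lambda>x. \<Prod>a\<in>S. f a x) \<in> poly_funs \<iota> n"
  using assms(2)
proof (induction S rule: infinite_finite_induct)
  case (insert a S)
  then have "(\<lambda>x. f a x * (\<Prod>a\<in>S. f a x)) \<in> poly_funs \<iota> n" by (intro poly_funs.mult) auto
  then show ?case using insert by simp
qed (use poly_funs.const[of \<iota> 1 n] assms(1) in simp_all)

text \<open>Leibniz expansion of the determinant. The conditions on \<open>\<iota>\<close> provide
  the constants 0, 1 and -1 that occur as empty sums, empty products and signs.\<close>

lemma det_gram_poly_fun:
  fixes \<iota> :: "'k::field \<Rightarrow> 'K::field"
  assumes "\<iota> 0 = 0" "\<iota> 1 = 1" "\<iota> (- 1) = - 1"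
  shows "(\<lambda>x. det (gram n x)) \<in> poly_funs \<iota> n"
proof -
  have t: "(\<lambda>x. trace_form n x i j) \<in> poly_funs \<iota> n" if "i < n" "j < n" for i j
    unfolding trace_form_def
    by (intro poly_funs_sum poly_funs.mult poly_funs.var) (use assms that in auto)
  have lt: "p i < n" if "p permutes {0..<n}" "i < n" for p :: "nat \<Rightarrow> nat" and i
    using permutes_in_image[OF that(1), of i] that(2) by simp
  have s: "(\<lambda>_. signof p) \<in> poly_funs \<iota> n" for p :: "nat \<Rightarrow> nat"
    using poly_funs.const[of \<iota> 1 n] poly_funs.const[of \<iota> "- 1" n] assms
    by (auto simp: sign_def)
  have "(\<lambda>x. \<Sum>p\<in>{p. p permutes {0..<n}}. signof p * (\<Prod>i\<in>{0..<n}. trace_form n x i (p i))) \<in> poly_funs \<iota> n"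
  proof (rule poly_funs_sum[where \<iota> = \<iota> and f = "\<lambda>p x. signof p * (\<Prod>i\<in>{0..<n}. trace_form n x i (p i))", OF assms(1)])
    fix p assume p: "p \<in> {p. p permutes {0..<n}}"
    have "(\<lambda>x. \<Prod>i\<in>{0..<n}. trace_form n x i (p i)) \<in> poly_funs \<iota> n"
    proof (rule poly_funs_prod[where \<iota> = \<iota> and f = "\<lambda>i x. trace_form n x i (p i)", OF assms(2)])
      fix i assume i: "i \<in> {0..<n}"
      have "i < n" "p i < n" using i p lt by auto
      then show "(\<lambda>x. trace_form n x i (p i)) \<in> poly_funs \<iota> n" by (rule t)
    qed
    then show "(\<lambda>x. signof p * (\<Prod>i\<in>{0..<n}. trace_form n x i (p i))) \<in> poly_funs \<iota> n"
      by (rule poly_funs.mult[OF s])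
  qed
  moreover have "det (gram n x) =
      (\<Sum>p\<in>{p. p permutes {0..<n}}. signof p * (\<Prod>i\<in>{0..<n}. trace_form n x i (p i)))" for x :: "'K strconst"
    unfolding det_def
    by (auto intro!: sum.cong prod.cong simp: lt)
  ultimately show ?thesis by simp
qed

text \<open>The map \<open>\<iota>\<close> is kept general for two uses: \<open>to_ac\<close> for
  geometric points with coefficients in the base field, and the identity when the base field itself
  is closed.\<close>

lemma U_Comm_zariski_open:
  fixes V :: "('K::field, 'v) module"
  assumes "based V e n" "\<iota> 0 = 0" "\<iota> 1 = 1" "\<iota> (- 1) = - 1"
  shows "zariski_open_in (\<iota> :: 'k::field \<Rightarrow> 'K) n (Comm n) (U_Comm V e n)"
proof -
  interpret based V e n by fact
  show ?thesis
    unfolding zariski_open_in_def U_Comm_def Delta_eq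
    using det_gram_poly_fun[of \<iota> n, OF assms(2-4)]
    by (intro exI[of _ "{\<lambda>x. det (gram n x)}"]) auto
qed

text \<open>Over the closure all points of the locus become conjugate, so the possibly infinitely
  many orbits over the base field are forms of one algebra. This makes the family of geometric
  orbits finite and each of them open.\<close>

lemma orbit_geom_eq:
  fixes V :: "('k::field_char_0, 'v) module"
  assumes "based V e n" "x \<in> U_Comm V e n"
  shows "orbit_geom n x = U_Comm_geom n"
  unfolding orbit_geom_def
  by (rule U_Comm_closed_orbit[OF _ unit_vec_basis U_Comm_to_ac[OF assms]]) (rule alg_closed_imp_poly_has_root)

text \<open>The carrier types \<open>'a\<close> and \<open>'b\<close> are arbitrary, so etale
  algebras on any types are classified; the algebras \<open>alg_of V e n x\<close> supply
  representatives on the type of \<open>V\<close> for every orbit.\<close>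

theorem corollary1p12:
  fixes V :: "('k::field_char_0, 'v) module" and e :: "nat \<Rightarrow> 'v" and n :: nat
  assumes "ordered_basis V e n"
  shows
    "((\<Union>x\<in>U_Comm V e n. orbit V e n x) = U_Comm V e n) \<and>
     (\<forall>x\<in>U_Comm V e n.
        finite_etale (alg_of V e n x) \<and> vectorspace.dim class_ring (alg_of V e n x) = n \<and>
        locus_of V e n (alg_of V e n x) = orbit V e n x) \<and>
     (\<forall>A :: ('k, 'a) module. finite_etale A \<and> vectorspace.dim class_ring A = n \<longrightarrow>
        (\<exists>x\<in>U_Comm V e n. locus_of V e n A = orbit V e n x)) \<and>
     (\<forall>(A :: ('k, 'a) module) (B :: ('k, 'b) module).
        finite_etale A \<and> vectorspace.dim class_ring A = n \<and>
        finite_etale B \<and> vectorspace.dim class_ring B = n \<longrightarrow>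
        (locus_of V e n A = locus_of V e n B \<longleftrightarrow> algebra_iso A B)) \<and>
     finite (orbit_geom n ` U_Comm V e n) \<and>
     (\<Union>x\<in>U_Comm V e n. orbit_geom n x) = U_Comm_geom n \<and>
     (\<forall>x\<in>U_Comm V e n. zariski_open_in (to_ac :: 'k \<Rightarrow> _) n (Comm n) (orbit_geom n x)) \<and>
     ((\<forall>p :: 'k poly. Polynomial.degree p > 0 \<longrightarrow> (\<exists>z. poly p z = 0)) \<longrightarrow>
        (\<exists>x\<in>U_Comm V e n. U_Comm V e n = orbit V e n x \<and>
           algebra_iso (alg_of V e n x) (coordinatewise_algebra n) \<and>
           zariski_open_in (\<lambda>c :: 'k. c) n (Comm n) (U_Comm V e n)))"
proof -
  have b: "based V e n" using assms ordered_basis_based by blast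
  interpret based V e n by (rule b)
  let ?U = "U_Comm V e n"
  have k: "kalg (alg_of V e n x)" if "x \<in> ?U" for x using U_Comm_imp_kalg[OF that] .
  have point: "\<exists>x\<in>?U. algebra_iso (alg_of V e n x) A"
    if fA: "finite_etale A" "vectorspace.dim class_ring A = n" for A :: "('k, 'c) module"
  proof -
    note A = finite_etaleD[OF fA(1)]
    interpret A: kalg A by (rule A(1))
    obtain b' where "ordered_basis A b' n" using A.exists_ordered_basis[OF A(2)] fA(2) by auto
    then show ?thesis using exists_U_Comm_point[OF b A(1,3)] by blast
  qed
  have locus: "locus_of V e n A = orbit V e n x"
    if "x \<in> ?U" "algebra_iso (alg_of V e n x) A" "finite_etale A" for x and A :: "('k, 'c) module"
    using locus_of_eq_orbit[OF k[OF that(1)] finite_etaleD(1)[OF that(3)] that(2)] .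
  have self: "x \<in> orbit V e n x" if "x \<in> ?U" for x
    using mem_orbit_self[OF k[OF that] U_Comm_strconsts[OF that]] .
  have 1: "(\<Union>x\<in>?U. orbit V e n x) = ?U"
    using self orbit_subset_U_Comm[OF b] by blast
  have 2: "finite_etale (alg_of V e n x) \<and> vectorspace.dim class_ring (alg_of V e n x) = n \<and>
      locus_of V e n (alg_of V e n x) = orbit V e n x" if x: "x \<in> ?U" for x
    using finite_etale_reduced[OF k[OF x] fin_dim_alg_of(1)[OF k[OF x]] U_Comm_imp_reduced[OF x]]
      fin_dim_alg_of(2)[OF k[OF x]] locus_of_eq_orbit[OF k[OF x] k[OF x] algebra_iso_refl] by blast
  have 3: "\<exists>x\<in>?U. locus_of V e n A = orbit V e n x"
    if "finite_etale A" "vectorspace.dim class_ring A = n" for A :: "('k, 'a) module"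
    using point[OF that] locus that(1) by blast
  have 4: "locus_of V e n A = locus_of V e n B \<longleftrightarrow> algebra_iso A B"
    if A: "finite_etale A" "vectorspace.dim class_ring A = n"
      and B: "finite_etale B" "vectorspace.dim class_ring B = n"
    for A :: "('k, 'a) module" and B :: "('k, 'b) module"
  proof -
    obtain x where x: "x \<in> ?U" "algebra_iso (alg_of V e n x) A" using point[OF A] by blast
    note lA = locus[OF x A(1)]
    show ?thesis
    proof
      assume "locus_of V e n A = locus_of V e n B"
      \<comment> \<open>\<open>x\<close> lies in its own orbit, which is the locus of
        \<open>A\<close>. Equality of the loci makes its algebra isomorphic to \<open>B\<close> as
        well.\<close>
      then have "x \<in> locus_of V e n B" using lA self[OF x(1)] by simp
      then have "algebra_iso (alg_of V e n x) B" unfolding locus_of_def by blast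
      then show "algebra_iso A B" using algebra_iso_trans[OF algebra_iso_sym[OF k[OF x(1)] x(2)]] by blast
    next
      assume "algebra_iso A B"
      then show "locus_of V e n A = locus_of V e n B"
        using lA locus[OF x(1) algebra_iso_trans[OF x(2)] B(1)] by simp
    qed
  qed
  have geom: "orbit_geom n x = U_Comm_geom n" if "x \<in> ?U" for x using orbit_geom_eq[OF b that] .
  obtain x0 where x0: "x0 \<in> ?U" using U_Comm_nonempty[OF b] by blast
  have 5: "finite (orbit_geom n ` ?U)"
    by (rule finite_subset[of _ "{U_Comm_geom n}"]) (use geom in auto)
  have 6: "(\<Union>x\<in>?U. orbit_geom n x) = U_Comm_geom n" using geom x0 by auto
  have 7: "zariski_open_in (to_ac :: 'k \<Rightarrow> _) n (Comm n) (orbit_geom n x)" if "x \<in> ?U" for x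
    unfolding geom[OF that] by (rule U_Comm_zariski_open[OF unit_vec_basis]) auto
  have 8: "\<exists>x\<in>?U. ?U = orbit V e n x \<and> algebra_iso (alg_of V e n x) (coordinatewise_algebra n) \<and>
      zariski_open_in (\<lambda>c :: 'k. c) n (Comm n) ?U"
    if closed: "\<forall>p :: 'k poly. Polynomial.degree p > 0 \<longrightarrow> (\<exists>z. poly p z = 0)"
    using U_Comm_closed_orbit[OF _ b x0] U_Comm_closed_iso[OF _ b x0] closed x0
      U_Comm_zariski_open[OF b, of "\<lambda>c. c"] by (intro bexI[of _ x0]) auto
  show ?thesis
    by (intro conjI ballI allI impI; (elim conjE)?)
      (rule 1 2[THEN conjunct1] 2[THEN conjunct2, THEN conjunct1] 2[THEN conjunct2, THEN conjunct2]
        3 4 5 6 7 8; assumption)+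
qed

end
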